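(* Let $(X,\sigma)$ be a symbolic system ($G$-subshift over a finite alphabet $\Lambda$) with the action of a countable (infinite, discrete) amenable group $G$, such that $\mathcal M_\sigma(X)$ is a Bauer simplex, that is, $\mathcal M_\sigma^{\mathsf{erg}}(X)$ is closed in $\mathcal M(X)$. Let $\bm{\mathsf T}$ be a F{\o}lner, deterministic system of dynamical tilings of $G$. Let $\mathcal U\supset\mathcal M_\sigma^{\mathsf{erg}}(X)$ be an open subset of $\mathcal B^*(X)\cup\mathcal M(X)$ (with the pseudometric $d^*$) and fix $\varepsilon>0$. Then there exists $j_0\in\mathbb N$ such that for every $j\ge j_0$ and every pair $(x,\bm{\mathcal T})\in X\times\bm{\mathsf T}$, $\bm{\mathcal T}=(\mathcal T_k)_{k\in\mathbb N}$, the union $M^{\mathsf{NE}}(x,\mathcal T_j)$ of the nonergodic tiles of $\mathcal T_j$ (i.e. of those tiles $T$ of $\mathcal T_j$ for which $x|_T\notin\mathcal U$) has upper Banach density in $G$ smaller than $\varepsilon$.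
   Context: F{\o}lner notions. A finite set $F\subset G$ (nonempty) is $(K,\delta)$-invariant, for finite $K\subset G$ and $\delta>0$, if $|F\triangle KF|/|F|<\delta$. A F{\o}lner sequence is a sequence of finite sets which, for every finite $K$ and $\delta>0$, are eventually $(K,\delta)$-invariant. $G$ is amenable if it has a F{\o}lner sequence. Upper Banach density of $A\subset G$: $\overline d_{\mathsf{Ban}}(A)=\inf_{F}\sup_{g\in G}\frac{|A\cap Fg|}{|F|}$, $F$ ranging over nonempty finite subsets of $G$. $G$-subshifts. $G$ acts on $\Lambda^G$ by $(g(x))(h)=x(hg)$; a $G$-subshift is a closed invariant $X\subset\Lambda^G$ with this action $\sigma$. A block with (finite, nonempty) domain $F\subset G$ is an element of $\Lambda^F$. For $C\in\Lambda^K$, $C'\in\Lambda^{Kg}$ write $C\approx C'$ if $C(k)=C'(kg)$ for all $k\in K$; $C$ occurs in $x$ if $x|_{Kg}\approx C$ for some $g\in G$. $\mathcal B^*(X)$ is the set of all finite blocks occurring in elements of $X$. The $K$-core of $F$ is $F_K=\{g\in F: Kg\subset F\}$. For $C\in\Lambda^K$, $B\in\Lambda^F$, $\mathrm{Fr}_B(C)=\frac{|\{g\in F_K: B|_{Kg}\approx C\}|}{|F|}$. $\mathcal M(X)$ = Borel probability measures on $X$ (weak-$\star$ topology), $\mathcal M_\sigma(X)$ = invariant ones, $\mathcal M_\sigma^{\mathsf{erg}}(X)$ = ergodic ones. For $C\in\Lambda^K$, $[C]=\{x\in X:x|_K=C\}$. Fix an enumeration $(K_l)_{l\in\mathbb N}$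 of all finite subsets of $G$. For $p\in\mathcal B^*(X)\cup\mathcal M(X)$ put $p(C)=\mathrm{Fr}_p(C)$ if $p$ is a block and $p(C)=p([C])$ if $p$ is a measure; the pseudometric is $d^*(p,q)=\sum_{l=1}^\infty\frac{2^{-l}}{|K_l|+1}\sum_{C\in\Lambda^{K_l}}|p(C)-q(C)|$ (on $\mathcal M(X)$ it is a metric compatible with the weak-$\star$ topology). Tilings. A tiling $\mathcal T$ of $G$ is a partition of $G$ into finite sets (tiles) for which there is a finite collection $\mathcal S$ of finite sets (shapes), each containing the unit $e$ (shapes in the collection need not all be different), such that each tile is $T=Sc$ for some $S\in\mathcal S$, $c\in T$. For each tile one such pair is chosen; $S$ is its shape and $c$ its center. $\mathcal T$ is identified with the element of $V^G$, $V=\{``S":S\in\mathcal S\}\cup\{``0"\}$, with $\mathcal T(g)=``S"$ if $g$ is the center of a tile of shape $S$, and $\mathcal T(g)=``0"$ otherwise. A dynamical tiling (with collection of shapes $\mathcal S$) is a nonempty closed shift-invariant set $\mathsf T\subset V^G$ consisting of tilings. A system of dynamical tilings $\bm{\mathsf T}=\bigvee_k\mathsf T_k$ is a topological joining of dynamical tilings $\mathsf T_k$ ($k\in\mathbb N$), i.e. a nonempty closed subset of $\prod_k\mathsf T_k$ invariant under the coordinatewise shift action. Let $\mathcal S_k$ be the collection of shapes of $\mathsf T_k$. The system is F{\o}lner if the shapes of all the $\mathcal S_k$, $k\in\mathbb N$, arranged in a sequence, form a F{\o}lner sequence (so for every finite $K$ and $\delta>0$ there is $k_0$ such that all $S\in\mathcal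 S_k$, $k\ge k_0$, are $(K,\delta)$-invariant). It is congruent if for each $(\mathcal T_k)_k\in\bm{\mathsf T}$ and each $k$, every tile of $\mathcal T_{k+1}$ is a union of tiles of $\mathcal T_k$. It is deterministic if it is congruent and for every $k$ and $S'\in\mathcal S_{k+1}$ there are sets $C_S(S')\subset G$, $S\in\mathcal S_k$, with $S'=\bigcup_{S\in\mathcal S_k}\bigcup_{c\in C_S(S')}Sc$, such that for each $(\mathcal T_l)_l\in\bm{\mathsf T}$, whenever $S'c'$ is a tile of $\mathcal T_{k+1}$, then $Scc'$ is a tile of $\mathcal T_k$ for every $S\in\mathcal S_k$ and $c\in C_S(S')$. *)

theory Defs
  imports "HOL-Probability.Probability"
begin

text \<open>
  The group \<open>G\<close> is a type of class \<^class>\<open>group_add\<close>, which is not assumed commutative: \<open>h + g\<close>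
  is the product \<open>hg\<close>, \<open>0\<close> is the unit \<open>e\<close>. Accordingly, for sets (as in
  \<^theory>\<open>HOL-Library.Set_Algebras\<close>), \<open>K + F\<close> is \<open>KF\<close> and \<open>F + {g}\<close> is the right translate \<open>Fg\<close>.
\<close>

section \<open>Folner sequences, amenability, upper Banach density\<close>

definition inv_under :: "'g::group_add set \<Rightarrow> real \<Rightarrow> 'g set \<Rightarrow> bool" where
  "inv_under K \<delta> F \<longleftrightarrow> finite F \<and> F \<noteq> {} \<and>
     real (card ((F - (K + F)) \<union> ((K + F) - F))) / real (card F) < \<delta>"

text \<open>
  The set \<open>K\<close> has to be nonempty: for \<open>K = {}\<close> the quotient above is always \<open>1\<close>, so no sequence
  would be eventually \<open>(K, \<delta>)\<close>-invariant for all \<open>\<delta>\<close>.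
\<close>

definition folner_seq :: "(nat \<Rightarrow> 'g::group_add set) \<Rightarrow> bool" where
  "folner_seq F \<longleftrightarrow> (\<forall>n. finite (F n)) \<and>
     (\<forall>K \<delta>. finite K \<and> K \<noteq> {} \<and> \<delta> > 0 \<longrightarrow> (\<forall>\<^sub>F n in sequentially. inv_under K \<delta> (F n)))"

definition amenable :: "'g::group_add itself \<Rightarrow> bool" where
  "amenable _ \<longleftrightarrow> (\<exists>F :: nat \<Rightarrow> 'g set. folner_seq F)"

definition upper_banach_density :: "'g::group_add set \<Rightarrow> real" where
  "upper_banach_density A =
     (INF F\<in>{F. finite F \<and> F \<noteq> {}}. SUP g. real (card (A \<inter> (F + {g}))) / real (card F))"

section \<open>Subshifts and blocks\<close>

definition shift :: "'g::group_add \<Rightarrow> ('g \<Rightarrow> 'b) \<Rightarrow> 'g \<Rightarrow> 'b" where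
  "shift g x = (\<lambda>h. x (h + g))"

definition subshift :: "('g::group_add \<Rightarrow> 'a::{finite, discrete_topology}) set \<Rightarrow> bool" where
  "subshift X \<longleftrightarrow> closed X \<and> (\<forall>g. \<forall>x\<in>X. shift g x \<in> X)"

text \<open>
  An element of \<open>\<Lambda>\<^sup>F\<close> is a partial function with domain \<open>F\<close>, so that a block carries its domain
  and equality of blocks is equality of functions.
\<close>

type_synonym ('g, 'a) block = "'g \<rightharpoonup> 'a"

definition blocks_on :: "'g set \<Rightarrow> ('g, 'a) block set" where
  "blocks_on K = {C. dom C = K}"

definition restr :: "('g \<Rightarrow> 'a) \<Rightarrow> 'g set \<Rightarrow> ('g, 'a) block" where
  "restr x F = (Some \<circ> x) |` F"

text \<open>\<open>matches C B g\<close> is \<open>B|\<^bsub>Kg\<^esub> \<approx> C\<close> with \<open>K = dom C\<close>.\<close>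

definition matches :: "('g::group_add, 'a) block \<Rightarrow> ('g, 'a) block \<Rightarrow> 'g \<Rightarrow> bool" where
  "matches C B g \<longleftrightarrow> (\<forall>k\<in>dom C. B (k + g) = C k)"

definition occurs_in :: "('g::group_add, 'a) block \<Rightarrow> ('g \<Rightarrow> 'a) \<Rightarrow> bool" where
  "occurs_in C x \<longleftrightarrow> (\<exists>g. matches C (Some \<circ> x) g)"

definition all_blocks :: "('g::group_add \<Rightarrow> 'a) set \<Rightarrow> ('g, 'a) block set" where
  "all_blocks X = {B. finite (dom B) \<and> dom B \<noteq> {} \<and> (\<exists>x\<in>X. occurs_in B x)}"

definition core :: "'g::group_add set \<Rightarrow> 'g set \<Rightarrow> 'g set" where
  "core K F = {g \<in> F. K + {g} \<subseteq> F}"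

definition Fr :: "('g::group_add, 'a) block \<Rightarrow> ('g, 'a) block \<Rightarrow> real" where
  "Fr B C = real (card {g \<in> core (dom C) (dom B). matches C B g}) / real (card (dom B))"

section \<open>Measures on a subshift\<close>

definition prob_measures :: "('g \<Rightarrow> 'a::topological_space) set \<Rightarrow> ('g \<Rightarrow> 'a) measure set" where
  "prob_measures X = {\<mu>. prob_space \<mu> \<and> space \<mu> = X \<and> sets \<mu> = sets (restrict_space borel X)}"

text \<open>
  The weak-star topology is the coarsest one making all the maps \<open>\<mu> \<mapsto> \<integral>f d\<mu>\<close>, \<open>f\<close> continuous on \<open>X\<close>,
  continuous. Its carrier is all of \<open>prob_measures X\<close> (take \<open>W = UNIV\<close>).
\<close>

definition weak_star :: "('g \<Rightarrow> 'a::topological_space) set \<Rightarrow> ('g \<Rightarrow> 'a) measure topology" where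
  "weak_star X = topology_generated_by
     {{\<mu> \<in> prob_measures X. (\<integral>x. f x \<partial>\<mu>) \<in> W} | (f :: ('g \<Rightarrow> 'a) \<Rightarrow> real) W.
        continuous_on X f \<and> open W}"

definition inv_measures ::
  "('g::group_add \<Rightarrow> 'a::topological_space) set \<Rightarrow> ('g \<Rightarrow> 'a) measure set" where
  "inv_measures X = {\<mu> \<in> prob_measures X. \<forall>g. distr \<mu> \<mu> (shift g) = \<mu>}"

definition erg_measures ::
  "('g::group_add \<Rightarrow> 'a::topological_space) set \<Rightarrow> ('g \<Rightarrow> 'a) measure set" where
  "erg_measures X = {\<mu> \<in> inv_measures X.
     \<forall>A\<in>sets \<mu>. (\<forall>g. shift g -` A \<inter> X = A) \<longrightarrow> measure \<mu> A = 0 \<or> measure \<mu> A = 1}"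

definition cylinder :: "('g \<Rightarrow> 'a) set \<Rightarrow> ('g, 'a) block \<Rightarrow> ('g \<Rightarrow> 'a) set" where
  "cylinder X C = {x \<in> X. restr x (dom C) = C}"

section \<open>The pseudometric on blocks and measures\<close>

type_synonym ('g, 'a) block_or_measure = "('g, 'a) block + ('g \<Rightarrow> 'a) measure"

definition blocks_and_measures ::
  "('g::group_add \<Rightarrow> 'a::topological_space) set \<Rightarrow> ('g, 'a) block_or_measure set" where
  "blocks_and_measures X = Inl ` all_blocks X \<union> Inr ` prob_measures X"

fun weight ::
  "('g::group_add \<Rightarrow> 'a) set \<Rightarrow> ('g, 'a) block_or_measure \<Rightarrow> ('g, 'a) block \<Rightarrow> real" where
  "weight X (Inl B) C = Fr B C"
| "weight X (Inr \<mu>) C = measure \<mu> (cylinder X C)"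

text \<open>
  \<open>K\<close> enumerates the finite subsets of \<open>G\<close>. It is indexed from \<open>0\<close>, so \<open>K l\<close> is the
  \<open>(l+1)\<close>-st set and gets the factor \<open>2\<^sup>-\<^sup>(\<^sup>l\<^sup>+\<^sup>1\<^sup>)\<close>.
\<close>

definition dstar :: "(nat \<Rightarrow> 'g::group_add set) \<Rightarrow> ('g \<Rightarrow> 'a) set \<Rightarrow>
    ('g, 'a) block_or_measure \<Rightarrow> ('g, 'a) block_or_measure \<Rightarrow> real" where
  "dstar K X p q = (\<Sum>l. (1 / 2) ^ Suc l / (real (card (K l)) + 1) *
     (\<Sum>C\<in>blocks_on (K l). \<bar>weight X p C - weight X q C\<bar>))"

definition dstar_open :: "(nat \<Rightarrow> 'g::group_add set) \<Rightarrow> ('g \<Rightarrow> 'a::topological_space) set \<Rightarrow>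
    ('g, 'a) block_or_measure set \<Rightarrow> bool" where
  "dstar_open K X U \<longleftrightarrow> U \<subseteq> blocks_and_measures X \<and>
     (\<forall>p\<in>U. \<exists>r>0. \<forall>q\<in>blocks_and_measures X. dstar K X p q < r \<longrightarrow> q \<in> U)"

section \<open>Tilings\<close>

text \<open>
  A collection of shapes, possibly with repetitions, is a list \<open>S\<close>. The symbol of the shape
  \<open>S ! i\<close> is \<open>Some i\<close>, and \<open>None\<close> is the symbol ``0''. A tiling is an element \<open>t\<close> of \<open>V\<^sup>G\<close>:
  \<open>t c = Some i\<close> says that \<open>c\<close> is the center of a tile of shape \<open>S ! i\<close>.
\<close>

definition shape_collection :: "'g::group_add set list \<Rightarrow> bool" where
  "shape_collection S \<longleftrightarrow> (\<forall>A\<in>set S. finite A \<and> 0 \<in> A)"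

definition symbols :: "'g set list \<Rightarrow> nat option set" where
  "symbols S = insert None (Some ` {..<length S})"

definition tile :: "'g::group_add set list \<Rightarrow> ('g \<Rightarrow> nat option) \<Rightarrow> 'g \<Rightarrow> 'g set" where
  "tile S t c = S ! the (t c) + {c}"

definition tiles :: "'g::group_add set list \<Rightarrow> ('g \<Rightarrow> nat option) \<Rightarrow> 'g set set" where
  "tiles S t = tile S t ` dom t"

text \<open>Injectivity says that one pair (shape, center) is chosen for each tile.\<close>

definition tiling :: "'g::group_add set list \<Rightarrow> ('g \<Rightarrow> nat option) \<Rightarrow> bool" where
  "tiling S t \<longleftrightarrow> range t \<subseteq> symbols S \<and> partition_on UNIV (tiles S t) \<and> inj_on (tile S t) (dom t)"

definition symbol_space :: "'g set list \<Rightarrow> ('g \<Rightarrow> nat option) topology" where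
  "symbol_space S = product_topology (\<lambda>_. discrete_topology (symbols S)) UNIV"

definition dynamical_tiling :: "'g::group_add set list \<Rightarrow> ('g \<Rightarrow> nat option) set \<Rightarrow> bool" where
  "dynamical_tiling S T \<longleftrightarrow> shape_collection S \<and> T \<noteq> {} \<and> closedin (symbol_space S) T \<and>
     (\<forall>g. \<forall>t\<in>T. shift g t \<in> T) \<and> (\<forall>t\<in>T. tiling S t)"

definition tiling_system :: "(nat \<Rightarrow> 'g::group_add set list) \<Rightarrow> (nat \<Rightarrow> ('g \<Rightarrow> nat option) set) \<Rightarrow>
    (nat \<Rightarrow> 'g \<Rightarrow> nat option) set \<Rightarrow> bool" where
  "tiling_system S T TT \<longleftrightarrow> (\<forall>k. dynamical_tiling (S k) (T k)) \<and> TT \<noteq> {} \<and>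
     closedin (product_topology (\<lambda>k. subtopology (symbol_space (S k)) (T k)) UNIV) TT \<and>
     (\<forall>g. \<forall>t\<in>TT. (\<lambda>k. shift g (t k)) \<in> TT)"

text \<open>The bijection \<open>b\<close> arranges the shapes of all the collections in one sequence.\<close>

definition folner_system :: "(nat \<Rightarrow> 'g::group_add set list) \<Rightarrow> bool" where
  "folner_system S \<longleftrightarrow> (\<exists>b. bij_betw b UNIV (SIGMA k:UNIV. {..<length (S k)}) \<and>
     folner_seq (\<lambda>n. S (fst (b n)) ! snd (b n)))"

definition congruent_system ::
  "(nat \<Rightarrow> 'g::group_add set list) \<Rightarrow> (nat \<Rightarrow> 'g \<Rightarrow> nat option) set \<Rightarrow> bool" where
  "congruent_system S TT \<longleftrightarrow> (\<forall>t\<in>TT. \<forall>k. \<forall>A\<in>tiles (S (Suc k)) (t (Suc k)).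
     \<exists>P\<subseteq>tiles (S k) (t k). A = \<Union>P)"

text \<open>
  Here, ``\<open>Sc\<close> is a tile'' means that it is a tile with shape \<open>S\<close> and center \<open>c\<close>.
\<close>

definition deterministic_system ::
  "(nat \<Rightarrow> 'g::group_add set list) \<Rightarrow> (nat \<Rightarrow> 'g \<Rightarrow> nat option) set \<Rightarrow> bool" where
  "deterministic_system S TT \<longleftrightarrow> congruent_system S TT \<and>
     (\<forall>k. \<forall>i'<length (S (Suc k)). \<exists>C :: nat \<Rightarrow> 'g set.
        S (Suc k) ! i' = (\<Union>i<length (S k). \<Union>c\<in>C i. S k ! i + {c}) \<and>
        (\<forall>t\<in>TT. \<forall>c'. t (Suc k) c' = Some i' \<longrightarrow>
           (\<forall>i<length (S k). \<forall>c\<in>C i. t k (c + c') = Some i)))"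

definition nonergodic_union :: "('g, 'a) block_or_measure set \<Rightarrow> 'g::group_add set list \<Rightarrow>
    ('g \<Rightarrow> 'a) \<Rightarrow> ('g \<Rightarrow> nat option) \<Rightarrow> 'g set" where
  "nonergodic_union U S x t = \<Union>{A \<in> tiles S t. Inl (restr x A) \<notin> U}"

end

theory Submission
  imports Defs
begin

text \<open>
  Suppose that for arbitrarily large \<open>j\<close> some pair \<open>(x\<^sub>j, t\<^sub>j)\<close> has nonergodic tiles of upper Banach density at
  least \<open>\<epsilon>\<close>. Averaging along a Folner sequence gives a translation-invariant mean \<open>m\<^sub>j\<close> on \<open>G\<close> that gives the
  union of these tiles mass at least \<open>\<epsilon> / 2\<close>. Taking \<open>m\<^sub>j\<close> extreme in a suitable sense, the measure
  \<open>\<mu>\<^sub>j\<close> on \<open>X\<close> with \<open>\<mu>\<^sub>j(A) = m\<^sub>j{g. g x\<^sub>j \<in> A}\<close> for clopen \<open>A\<close> is ergodic, so by the Bauer property the \<open>\<mu>\<^sub>j\<close>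
  accumulate at an ergodic measure \<open>\<nu>\<close>. A nonergodic tile is \<open>d\<^sup>*\<close>-far from \<open>\<nu>\<close>, hence some block \<open>C\<close> out of a
  finite list occurs in it with frequency at least \<open>\<nu>[C] + \<eta>\<close>. The tiles belonging to one such \<open>C\<close> form
  almost invariant subsets of \<open>G\<close>, so the part of \<open>\<mu>\<^sub>j\<close> that they carry converges to an invariant \<open>\<alpha> \<le> \<nu>\<close>. By
  ergodicity \<open>\<alpha>\<close> is a multiple of \<open>\<nu>\<close>, while its frequency of \<open>C\<close> is too high; therefore \<open>\<alpha> = 0\<close>, a
  contradiction.
\<close>

section \<open>Invariant means\<close>

text \<open>Which tiles are nonergodic depends on the tiling as well as on x, so their union is a
  subset of G that no measure on X can see. A mean, defined on every subset of G, records its mass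
  together with the statistics of the orbit of x. The price is that means are only finitely additive
  and live in a cube of uncountable dimension. The Bauer property speaks of ergodic measures only,
  whereas averaging need not produce one, and an ergodic decomposition of the induced measure would
  say nothing about the tile mass. Therefore the mean itself is what gets split: the means of
  maximal mass on the tiles form a face, and a suitably extreme point of this face keeps the mass
  and induces an ergodic measure. Only an excess of occurrences can be exploited, because counting
  inside tiles bounds the visits to a cylinder from below. This suffices, as a nearly normalized
  distribution far from a normalized one must exceed it somewhere.\<close>

definition fin_additive :: "('b set \<Rightarrow> real) \<Rightarrow> bool" where
  "fin_additive m \<longleftrightarrow> (\<forall>D. 0 \<le> m D) \<and> (\<forall>D E. D \<inter> E = {} \<longrightarrow> m (D \<union> E) = m D + m E)"

text \<open>Invariance is under left translation. Since
  \<open>shift h (shift g x) = shift (h + g) x\<close>, it becomes shift invariance of the induced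
  measure, and it is the side on which Folner sets are almost invariant.\<close>

definition invariant_mean :: "('g::group_add set \<Rightarrow> real) \<Rightarrow> bool" where
  "invariant_mean m \<longleftrightarrow> fin_additive m \<and> m UNIV = 1 \<and> (\<forall>h D. m {g. h + g \<in> D} = m D)"

lemma fin_additive_nonneg: "fin_additive m \<Longrightarrow> 0 \<le> m D"
  by (simp add: fin_additive_def)

lemma fin_additive_Un: "fin_additive m \<Longrightarrow> D \<inter> E = {} \<Longrightarrow> m (D \<union> E) = m D + m E"
  by (simp add: fin_additive_def)

lemma fin_additive_empty: "fin_additive m \<Longrightarrow> m {} = 0"
  using fin_additive_Un[of m "{}" "{}"] by simp

lemma fin_additive_Diff: "fin_additive m \<Longrightarrow> m (D - E) = m D - m (D \<inter> E)"
  using fin_additive_Un[of m "D \<inter> E" "D - E"] by (simp add: Int_Diff_Un Int_Diff_disjoint)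

lemma fin_additive_mono: "fin_additive m \<Longrightarrow> D \<subseteq> E \<Longrightarrow> m D \<le> m E"
  using fin_additive_Diff[of m E D] fin_additive_nonneg[of m "E - D"] by (simp add: Int_absorb1)

lemma fin_additive_Int_diff_le:
  assumes "fin_additive m"
  shows "\<bar>m (D \<inter> E) - m (D \<inter> F)\<bar> \<le> m ((E - F) \<union> (F - E))"
proof -
  have "m (D \<inter> A) \<le> m (D \<inter> B) + m ((E - F) \<union> (F - E))"
    if "A - B \<subseteq> (E - F) \<union> (F - E)" for A B
  proof -
    have "m (D \<inter> A) = m (D \<inter> A \<inter> B) + m (D \<inter> A - B)"
      using fin_additive_Diff[OF assms, of "D \<inter> A" B] by simp
    also have "m (D \<inter> A \<inter> B) \<le> m (D \<inter> B)"
      by (intro fin_additive_mono[OF assms]) auto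
    also have "m (D \<inter> A - B) \<le> m ((E - F) \<union> (F - E))"
      using that by (intro fin_additive_mono[OF assms]) auto
    finally show ?thesis by simp
  qed
  from this[of E F] this[of F E] show ?thesis by (simp add: abs_le_iff)
qed

lemma fin_additive_UN:
  assumes "fin_additive m" "finite I" "disjoint_family_on D I"
  shows "m (\<Union>i\<in>I. D i) = (\<Sum>i\<in>I. m (D i))"
  using assms(2,3)
proof (induction I rule: finite_induct)
  case empty
  then show ?case using fin_additive_empty[OF assms(1)] by simp
next
  case (insert i I)
  have "D i \<inter> (\<Union>i\<in>I. D i) = {}"
    using insert by (auto simp: disjoint_family_on_def)
  moreover have "disjoint_family_on D I"
    using insert.prems by (rule disjoint_family_on_mono[rotated]) auto
  ultimately show ?case
    using insert fin_additive_Un[OF assms(1)] by simp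
qed

lemma fin_additive_UN_le:
  assumes "fin_additive m" "finite I"
  shows "m (\<Union>i\<in>I. D i) \<le> (\<Sum>i\<in>I. m (D i))"
  using assms(2)
proof (induction I rule: finite_induct)
  case empty
  then show ?case using fin_additive_empty[OF assms(1)] by simp
next
  case (insert i I)
  have "m (D i \<union> (\<Union>i\<in>I. D i)) = m (D i) + m ((\<Union>i\<in>I. D i) - D i)"
    using fin_additive_Un[OF assms(1), of "D i" "(\<Union>i\<in>I. D i) - D i"] by (simp add: Un_Diff_cancel)
  also have "m ((\<Union>i\<in>I. D i) - D i) \<le> m (\<Union>i\<in>I. D i)"
    by (intro fin_additive_mono[OF assms(1)]) auto
  finally show ?case using insert by simp
qed

lemma fin_additive_vimage:
  assumes "fin_additive m"
  shows "fin_additive (\<lambda>A. m (D \<inter> {g. f g \<in> A}))"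
  unfolding fin_additive_def
proof (intro conjI allI impI)
  show "0 \<le> m (D \<inter> {g. f g \<in> A})" for A
    using fin_additive_nonneg[OF assms] .
  show "m (D \<inter> {g. f g \<in> A \<union> B}) = m (D \<inter> {g. f g \<in> A}) + m (D \<inter> {g. f g \<in> B})"
    if "A \<inter> B = {}" for A B
    using that by (subst fin_additive_Un[OF assms, symmetric]) (auto intro!: arg_cong[where f=m])
qed

lemma fin_additive_limit:
  assumes "F \<noteq> bot" "\<forall>\<^sub>F i in F. fin_additive (f i)" "\<And>D. ((\<lambda>i. f i D) \<longlongrightarrow> m D) F"
  shows "fin_additive m"
  unfolding fin_additive_def
proof (intro conjI allI impI)
  show "0 \<le> m D" for D
    by (rule tendsto_lowerbound[OF assms(3) _ assms(1)])
      (use assms(2) in eventually_elim, auto intro: fin_additive_nonneg)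
  fix D E :: "'b set" assume "D \<inter> E = {}"
  then have "\<forall>\<^sub>F i in F. f i (D \<union> E) = f i D + f i E"
    using assms(2) by (auto elim!: eventually_mono simp: fin_additive_Un)
  then have "((\<lambda>i. f i (D \<union> E)) \<longlongrightarrow> m D + m E) F"
    using tendsto_add[OF assms(3) assms(3)] by (simp add: tendsto_cong)
  with assms(3) show "m (D \<union> E) = m D + m E"
    by (intro tendsto_unique[OF assms(1)])
qed

lemma invariant_mean_le_1: "invariant_mean m \<Longrightarrow> m D \<le> 1"
  using fin_additive_mono[of m D UNIV] by (simp add: invariant_mean_def)

lemma compact_PiE_Icc: "compact (PiE UNIV (\<lambda>_::'b. {0..1::real}))"
proof -
  have "compactin (product_topology (\<lambda>_::'b. euclidean) UNIV) (PiE UNIV (\<lambda>_. {0..1::real}))"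
    by (subst compactin_PiE) auto
  then show ?thesis by (simp add: euclidean_product_topology)
qed

text \<open>Compactness of \<open>[0, 1]\<^sup>B\<close> for an uncountable \<open>B\<close> gives no convergent subsequences; finer
  filters take their place.\<close>

lemma convergent_finer_filter:
  fixes f :: "'i \<Rightarrow> 'b \<Rightarrow> real"
  assumes "F \<noteq> bot" "\<And>i b. 0 \<le> f i b" "\<And>i b. f i b \<le> 1"
  obtains F' l where "F' \<noteq> bot" "F' \<le> F" "\<And>b. ((\<lambda>i. f i b) \<longlongrightarrow> l b) F'"
proof -
  let ?P = "PiE UNIV (\<lambda>_::'b. {0..1::real})"
  have "filtermap f F \<noteq> bot" "eventually (\<lambda>x. x \<in> ?P) (filtermap f F)"
    using assms by (auto simp: filtermap_bot_iff eventually_filtermap PiE_def)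
  then obtain l where l: "inf (nhds l) (filtermap f F) \<noteq> bot"
    using compact_PiE_Icc[where 'b='b] unfolding compact_filter by blast
  \<comment> \<open>\<open>l\<close> is a cluster point of \<open>f\<close> along \<open>F\<close>.
    Adding the preimages of its neighbourhoods to \<open>F\<close> forces convergence to
    \<open>l\<close>, and clustering is what keeps the filter proper.\<close>
  define F' where "F' = inf F (filtercomap f (nhds l))"
  have "F' \<noteq> bot"
  proof
    assume "F' = bot"
    then obtain P Q where "eventually P F" "eventually Q (nhds l)" "\<And>i. \<not> (P i \<and> Q (f i))"
      unfolding F'_def trivial_limit_def eventually_inf eventually_filtercomap by metis
    moreover from this have "eventually (\<lambda>x. \<not> Q x) (filtermap f F)"
      by (auto simp: eventually_filtermap elim: eventually_mono)
    ultimately have "eventually (\<lambda>_. False) (inf (nhds l) (filtermap f F))"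
      unfolding eventually_inf by blast
    with l show False by (simp add: trivial_limit_def)
  qed
  moreover have lim: "filterlim f (nhds l) F'"
    unfolding F'_def filterlim_iff_le_filtercomap by simp
  have "((\<lambda>i. f i b) \<longlongrightarrow> l b) F'" for b
    by (rule continuous_on_tendsto_compose[OF continuous_on_product_coordinates[of b] lim]) auto
  ultimately show ?thesis by (intro that[of F' l]) (auto simp: F'_def)
qed

section \<open>Folner averages and upper Banach density\<close>

lemma folner_seq_left_translate:
  fixes F :: "nat \<Rightarrow> 'g::group_add set"
  assumes "folner_seq F"
  shows "(\<lambda>n. real (card ((F n - (\<lambda>g. h + g) ` F n) \<union> ((\<lambda>g. h + g) ` F n - F n)))
            / real (card (F n))) \<longlonglongrightarrow> 0"
proof (rule tendstoI)
  fix e :: real assume "e > 0"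
  then have "\<forall>\<^sub>F n in sequentially. inv_under {h} e (F n)"
    using assms unfolding folner_seq_def by (metis finite.emptyI finite.insertI insert_not_empty)
  then show "\<forall>\<^sub>F n in sequentially. dist (real (card ((F n - (\<lambda>g. h + g) ` F n) \<union>
      ((\<lambda>g. h + g) ` F n - F n))) / real (card (F n))) 0 < e"
  proof eventually_elim
    case (elim n)
    moreover have "{h} + F n = (\<lambda>g. h + g) ` F n" by (auto simp: set_plus_def)
    ultimately show ?case by (simp add: inv_under_def)
  qed
qed

lemma card_Int_translate_diff:
  fixes A :: "'g::group_add set"
  assumes "finite A"
  shows "\<bar>real (card ({g. h + g \<in> D} \<inter> A)) - real (card (D \<inter> A))\<bar>
     \<le> real (card ((A - (\<lambda>g. h + g) ` A) \<union> ((\<lambda>g. h + g) ` A - A)))"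
proof -
  let ?hA = "(\<lambda>g. h + g) ` A"
  have "(\<lambda>g. h + g) ` ({g. h + g \<in> D} \<inter> A) = D \<inter> ?hA" by auto
  then have "card ({g. h + g \<in> D} \<inter> A) = card (D \<inter> ?hA)"
    by (metis card_image inj_on_add)
  moreover have "card (D \<inter> ?hA) \<le> card (D \<inter> A) + card ((A - ?hA) \<union> (?hA - A))"
    using assms by (intro order.trans[OF card_mono card_Un_le]) auto
  moreover have "card (D \<inter> A) \<le> card (D \<inter> ?hA) + card ((A - ?hA) \<union> (?hA - A))"
    using assms by (intro order.trans[OF card_mono card_Un_le]) auto
  ultimately show ?thesis by linarith
qed

text \<open>The density is an infimum over finite sets, so every nonempty Folner set has a right
  translate in which \<open>M\<close> has frequency above \<open>c\<close>. Right translations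
  commute with left ones, so these translates are again asymptotically left invariant, and a limit
  of their counting frequencies is an invariant mean.\<close>

lemma upper_banach_density_mean:
  fixes M :: "'g::group_add set"
  assumes "amenable TYPE('g)" "c < upper_banach_density M"
  obtains m where "invariant_mean m" "c \<le> m M"
proof -
  obtain F :: "nat \<Rightarrow> 'g set" where F: "folner_seq F"
    using assms(1) by (auto simp: amenable_def)
  have fin: "finite (F n)" for n using F by (simp add: folner_seq_def)
  have ev: "\<forall>\<^sub>F n in sequentially. F n \<noteq> {}"
  proof -
    have "\<forall>\<^sub>F n in sequentially. inv_under {0} 1 (F n)"
      using F by (simp add: folner_seq_def)
    then show ?thesis by eventually_elim (simp add: inv_under_def)
  qed
  let ?d = "\<lambda>A g. real (card (M \<inter> (A + {g}))) / real (card A)"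
  have "\<exists>g. c < ?d (F n) g" if "F n \<noteq> {}" for n
  proof (rule ccontr)
    assume "\<not> ?thesis"
    then have "(SUP g. ?d (F n) g) \<le> c" by (intro cSUP_least) (auto simp: not_less)
    moreover have "upper_banach_density M \<le> (SUP g. ?d (F n) g)"
      unfolding upper_banach_density_def
    proof (rule cINF_lower)
      have "0 \<le> (SUP g. ?d A g)" if "finite A" for A
      proof (rule order.trans[OF _ cSUP_upper[of 0]])
        have "?d A g \<le> 1" for g
        proof -
          have "A + {g} = (\<lambda>a. a + g) ` A" by (auto simp: set_plus_def)
          then have "card (M \<inter> (A + {g})) \<le> card A"
            using that by (metis card_image_le card_mono finite_imageI inf_le2 order.trans)
          then show ?thesis by (auto simp: divide_le_eq_1)
        qed
        then show "bdd_above (range (?d A))" by (intro bdd_aboveI[of _ 1]) auto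
      qed auto
      then show "bdd_below ((\<lambda>F. SUP g. ?d F g) ` {F. finite F \<and> F \<noteq> {}})"
        by (intro bdd_belowI[of _ 0]) auto
    qed (use fin that in auto)
    ultimately show False using assms(2) by simp
  qed
  then obtain t where t: "\<And>n. F n \<noteq> {} \<Longrightarrow> c < ?d (F n) (t n)" by metis
  define E where "E n = F n + {t n}" for n
  have E_eq: "E n = (\<lambda>a. a + t n) ` F n" for n by (auto simp: E_def set_plus_def)
  have finE: "finite (E n)" for n by (simp add: E_eq fin)
  have cardE: "card (E n) = card (F n)" for n
    unfolding E_eq by (intro card_image) (auto simp: inj_on_def)
  define f where "f n D = real (card (D \<inter> E n)) / real (card (F n))" for n D
  have f_le_1: "f n D \<le> 1" for n D
    using card_mono[OF finE, of "D \<inter> E n" n] by (auto simp: f_def cardE divide_le_eq_1)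
  obtain F' m where F': "F' \<noteq> bot" "F' \<le> sequentially" "\<And>D. ((\<lambda>n. f n D) \<longlongrightarrow> m D) F'"
    by (rule convergent_finer_filter[of sequentially f]) (use f_le_1 in \<open>auto simp: f_def\<close>)
  have ev': "\<forall>\<^sub>F n in F'. F n \<noteq> {}" using ev F'(2) by (simp add: le_filter_def)
  have "fin_additive (f n)" for n
    unfolding fin_additive_def
  proof (intro conjI allI impI)
    fix A B :: "'g set" assume "A \<inter> B = {}"
    then have "card ((A \<union> B) \<inter> E n) = card (A \<inter> E n) + card (B \<inter> E n)"
      using finE by (subst card_Un_disjoint[symmetric]) (auto intro!: arg_cong[where f=card])
    then show "f n (A \<union> B) = f n A + f n B" by (simp add: f_def add_divide_distrib)
  qed (simp add: f_def)
  then have add: "fin_additive m" by (intro fin_additive_limit[OF F'(1) _ F'(3)]) simp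
  have "m UNIV = 1"
  proof (rule tendsto_unique[OF F'(1) F'(3)])
    show "((\<lambda>n. f n UNIV) \<longlongrightarrow> 1) F'"
      by (rule tendsto_eventually, rule eventually_mono[OF ev'])
        (simp add: f_def cardE card_eq_0_iff fin)
  qed
  moreover have "m {g. h + g \<in> D} = m D" for h D
  proof -
    have le: "norm (f n {g. h + g \<in> D} - f n D) \<le>
        real (card ((F n - (\<lambda>g. h + g) ` F n) \<union> ((\<lambda>g. h + g) ` F n - F n))) / real (card (F n))" for n
    proof -
      let ?r = "\<lambda>a. a + t n"
      have r: "inj ?r" by (auto simp: inj_on_def)
      have 1: "(\<lambda>g. h + g) ` E n = ?r ` (\<lambda>g. h + g) ` F n"
        by (auto simp: E_eq image_image add.assoc)
      have "(E n - (\<lambda>g. h + g) ` E n) \<union> ((\<lambda>g. h + g) ` E n - E n)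
          = ?r ` ((F n - (\<lambda>g. h + g) ` F n) \<union> ((\<lambda>g. h + g) ` F n - F n))"
        unfolding 1 unfolding E_eq by (simp only: image_Un image_set_diff[OF r])
      then have "card ((E n - (\<lambda>g. h + g) ` E n) \<union> ((\<lambda>g. h + g) ` E n - E n))
          = card ((F n - (\<lambda>g. h + g) ` F n) \<union> ((\<lambda>g. h + g) ` F n - F n))"
        by (metis card_image inj_on_subset r subset_UNIV)
      with card_Int_translate_diff[OF finE, of h D n] show ?thesis
        unfolding f_def diff_divide_distrib[symmetric] by (simp add: divide_right_mono)
    qed
    have "((\<lambda>n. f n {g. h + g \<in> D} - f n D) \<longlongrightarrow> 0) F'"
      using le by (intro Lim_null_comparison[OF _ tendsto_mono[OF F'(2) folner_seq_left_translate[OF F, of h]]] always_eventually)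
        auto
    with tendsto_diff[OF F'(3) F'(3)] show ?thesis
      using tendsto_unique[OF F'(1)] by fastforce
  qed
  ultimately have "invariant_mean m" using add by (simp add: invariant_mean_def)
  moreover have "c \<le> m M"
  proof (rule tendsto_lowerbound[OF F'(3) _ F'(1)])
    show "\<forall>\<^sub>F n in F'. c \<le> f n M"
      using ev' by eventually_elim (use t in \<open>auto simp: f_def E_def less_imp_le\<close>)
  qed
  ultimately show ?thesis by (rule that)
qed

section \<open>Extremal invariant means\<close>

text \<open>Every axiom is a closed condition on finitely many coordinates, so the means form a
  closed subset of the compact cube.\<close>

lemma compact_invariant_means: "compact {m :: 'g::group_add set \<Rightarrow> real. invariant_mean m}"
proof -
  have cont[continuous_intros]: "continuous_on UNIV (\<lambda>m :: 'g set \<Rightarrow> real. m D)" for D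
    by (rule continuous_on_product_coordinates)
  have bounds: "0 \<le> m D \<and> m D \<le> 1" if "invariant_mean m" for m :: "'g set \<Rightarrow> real" and D
    using that invariant_mean_le_1[OF that] by (simp add: invariant_mean_def fin_additive_nonneg)
  have "{m :: 'g set \<Rightarrow> real. invariant_mean m} =
      (\<Inter>D. {m. 0 \<le> m D}) \<inter> (\<Inter>D. \<Inter>E\<in>{E. D \<inter> E = {}}. {m. m (D \<union> E) = m D + m E}) \<inter>
      {m. m UNIV = 1} \<inter> (\<Inter>h. \<Inter>D. {m. m {g. h + g \<in> D} = m D})"
    by (auto simp: invariant_mean_def fin_additive_def)
  also have "closed \<dots>"
    by (intro closed_Int closed_INT ballI closed_Collect_le closed_Collect_eq continuous_intros)
  finally have "closed {m :: 'g set \<Rightarrow> real. invariant_mean m}" .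
  then have "compact (PiE UNIV (\<lambda>_. {0..1}) \<inter> {m :: 'g set \<Rightarrow> real. invariant_mean m})"
    by (rule compact_Int_closed[OF compact_PiE_Icc])
  also have "PiE UNIV (\<lambda>_. {0..1}) \<inter> {m :: 'g set \<Rightarrow> real. invariant_mean m} = {m. invariant_mean m}"
    using bounds by auto
  finally show ?thesis .
qed

text \<open>Among the means giving \<open>M\<close> the largest value, a maximizer of a strictly convex functional of the
  values on the sets \<open>E n\<close> is extreme as far as these values are concerned.\<close>

lemma extremal_mean:
  fixes E :: "nat \<Rightarrow> 'g::group_add set"
  assumes "invariant_mean m\<^sub>0" "c \<le> m\<^sub>0 M"
  obtains m where "invariant_mean m" "c \<le> m M"
    "\<And>m\<^sub>1 m\<^sub>2 s n. invariant_mean m\<^sub>1 \<Longrightarrow> invariant_mean m\<^sub>2 \<Longrightarrow> 0 < s \<Longrightarrow> s < 1 \<Longrightarrow>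
       (\<And>D. m D = s * m\<^sub>1 D + (1 - s) * m\<^sub>2 D) \<Longrightarrow> m\<^sub>1 (E n) = m (E n)"
proof -
  let ?P = "{m :: 'g set \<Rightarrow> real. invariant_mean m}"
  have cont[continuous_intros]: "continuous_on A (\<lambda>m :: 'g set \<Rightarrow> real. m D)" for A D
    by (rule continuous_on_subset[OF continuous_on_product_coordinates]) auto
  obtain p where p: "p \<in> ?P" "\<And>m. m \<in> ?P \<Longrightarrow> m M \<le> p M"
    using continuous_attains_sup[OF compact_invariant_means _ cont, of M] assms(1) by blast
  \<comment> \<open>\<open>Q\<close> is a face: if a proper convex combination of two means lies in
    it, so do both means.\<close>
  define Q where "Q = ?P \<inter> {m. m M = p M}"
  have "compact Q" unfolding Q_def
    by (intro compact_Int_closed compact_invariant_means closed_Collect_eq continuous_intros)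
  \<comment> \<open>The geometric weights make the series converge uniformly, so the functional is
    continuous on \<open>Q\<close> and attains its maximum.\<close>
  define w where "w m n = (1/2)^n * (m (E n))\<^sup>2" for m :: "'g set \<Rightarrow> real" and n
  have w_le: "norm (w m n) \<le> (1/2)^n" if "invariant_mean m" for m n
  proof -
    have "0 \<le> m (E n)" "m (E n) \<le> 1"
      using that invariant_mean_le_1[OF that] by (auto simp: invariant_mean_def fin_additive_def)
    then have "(m (E n))\<^sup>2 \<le> 1" by (simp add: power_le_one)
    then show ?thesis by (simp add: w_def mult_left_le)
  qed
  have half: "summable (\<lambda>n. (1/2::real)^n)" by (simp add: summable_geometric)
  have w_sum: "summable (w m)" if "invariant_mean m" for m
    using w_le[OF that] by (intro summable_comparison_test'[OF half]) auto
  have "continuous_on Q (\<lambda>m. \<Sum>n. w m n)"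
  proof (rule uniform_limit_theorem)
    show "uniform_limit Q (\<lambda>n m. \<Sum>i<n. w m i) (\<lambda>m. \<Sum>n. w m n) sequentially"
      by (rule Weierstrass_m_test[OF _ half]) (use w_le in \<open>auto simp: Q_def\<close>)
    show "\<forall>\<^sub>F n in sequentially. continuous_on Q (\<lambda>m. \<Sum>i<n. w m i)"
      unfolding w_def by (intro always_eventually allI continuous_intros)
  qed simp
  then obtain m where m: "m \<in> Q" "\<And>m'. m' \<in> Q \<Longrightarrow> (\<Sum>n. w m' n) \<le> (\<Sum>n. w m n)"
    using continuous_attains_sup[OF \<open>compact Q\<close>, of "\<lambda>m. \<Sum>n. w m n"] p(1) by (auto simp: Q_def)
  show ?thesis
  proof (rule that)
    show "invariant_mean m" using m by (simp add: Q_def)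
    show "c \<le> m M" using m(1) p(2)[of m\<^sub>0] assms by (simp add: Q_def)
    fix m\<^sub>1 m\<^sub>2 s n
    assume inv: "invariant_mean m\<^sub>1" "invariant_mean m\<^sub>2" and s: "0 < s" "s < 1"
      and conv: "\<And>D. m D = s * m\<^sub>1 D + (1 - s) * m\<^sub>2 D"
    have "m\<^sub>1 M \<le> m M" "m\<^sub>2 M \<le> m M" using p(2) inv m(1) by (auto simp: Q_def)
    moreover have "s * (m M - m\<^sub>1 M) + (1 - s) * (m M - m\<^sub>2 M) = 0"
      using conv[of M] by (simp add: algebra_simps)
    moreover have "0 \<le> s * (m M - m\<^sub>1 M)" "0 \<le> (1 - s) * (m M - m\<^sub>2 M)"
      using s calculation(1,2) by simp_all
    ultimately have "s * (m M - m\<^sub>1 M) = 0" "(1 - s) * (m M - m\<^sub>2 M) = 0" by linarith+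
    then have Q12: "m\<^sub>1 \<in> Q" "m\<^sub>2 \<in> Q" using s inv m(1) by (auto simp: Q_def)
    \<comment> \<open>Strict convexity in quantified form: the square of
      \<open>s * a + (1 - s) * b\<close> falls short of the combination of the squares by exactly
      \<open>s * (1 - s) * (a - b)^2\<close>. By maximality the weighted sum of these gaps is at
      most 0, so each gap vanishes.\<close>
    define d where "d n = (1/2)^n * (m\<^sub>1 (E n) - m\<^sub>2 (E n))\<^sup>2" for n
    have eq: "s * (1 - s) * d n = s * w m\<^sub>1 n + (1 - s) * w m\<^sub>2 n - w m n" for n
      unfolding w_def d_def conv by (simp add: power2_eq_square algebra_simps)
    have sums: "summable (w m)" "summable (w m\<^sub>1)" "summable (w m\<^sub>2)"
      using w_sum inv m(1) by (auto simp: Q_def)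
    have "(\<lambda>n. s * (1 - s) * d n) sums (s * (\<Sum>n. w m\<^sub>1 n) + (1 - s) * (\<Sum>n. w m\<^sub>2 n) - (\<Sum>n. w m n))"
      unfolding eq by (intro sums_diff sums_add sums_mult summable_sums sums)
    moreover have "s * (\<Sum>n. w m\<^sub>1 n) + (1 - s) * (\<Sum>n. w m\<^sub>2 n) \<le> s * (\<Sum>n. w m n) + (1 - s) * (\<Sum>n. w m n)"
      using s m(2) Q12 by (intro add_mono mult_left_mono) auto
    ultimately have "(\<Sum>n. s * (1 - s) * d n) \<le> 0" "summable (\<lambda>n. s * (1 - s) * d n)"
      by (auto simp: sums_iff algebra_simps)
    moreover have nn: "0 \<le> s * (1 - s) * d n" for n using s by (simp add: d_def)
    ultimately have "s * (1 - s) * d n = 0"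
      using suminf_eq_zero_iff suminf_nonneg by (metis order.antisym)
    then have "m\<^sub>1 (E n) = m\<^sub>2 (E n)" using s by (simp add: d_def)
    then show "m\<^sub>1 (E n) = m (E n)" using conv[of "E n"] by (simp add: algebra_simps)
  qed
qed

section \<open>Measures on a closed set of configurations\<close>

text \<open>Clopen relative to \<open>X\<close>. For a subshift this algebra is countable, shift
  invariant and generates the Borel sets; a finitely additive function on it is already a measure,
  so means and measures meet here.\<close>

definition clopens :: "'b::topological_space set \<Rightarrow> 'b set set" where
  "clopens X = {A. openin (top_of_set X) A \<and> closedin (top_of_set X) A}"

lemma clopens_subset: "A \<in> clopens X \<Longrightarrow> A \<subseteq> X"
  by (auto simp: clopens_def dest: openin_imp_subset)

lemma algebra_clopens: "algebra X (clopens X)"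
  unfolding algebra_iff_Un
  by (auto simp: clopens_def dest: openin_imp_subset intro: openin_diff closedin_diff)

lemma compact_closed_configurations:
  fixes X :: "('g \<Rightarrow> 'a::{finite, topological_space}) set"
  assumes "closed X"
  shows "compact X"
proof -
  have "compactin (product_topology (\<lambda>_::'g. euclidean) UNIV) (PiE UNIV (\<lambda>_. UNIV :: 'a set))"
    by (subst compactin_PiE) (auto intro: finite_imp_compact)
  then have "compact (UNIV :: ('g \<Rightarrow> 'a) set)"
    by (simp add: euclidean_product_topology)
  then show ?thesis using compact_Int_closed[OF _ assms] by force
qed

lemma cylinder_eq: "cylinder X C = {x \<in> X. \<forall>k\<in>dom C. C k = Some (x k)}"
proof -
  have "restr x (dom C) = C \<longleftrightarrow> (\<forall>k\<in>dom C. C k = Some (x k))" for x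
    unfolding fun_eq_iff restr_def restrict_map_def by (metis comp_apply domIff)
  then show ?thesis by (simp add: cylinder_def)
qed

lemma cylinder_clopen:
  fixes X :: "('g \<Rightarrow> 'a::discrete_topology) set"
  assumes "finite (dom C)"
  shows "cylinder X C \<in> clopens X"
proof -
  have eq: "cylinder X C = X \<inter> (\<Inter>k\<in>dom C. (\<lambda>x. x k) -` {a. C k = Some a})"
    by (auto simp: cylinder_eq)
  have "open (\<Inter>k\<in>dom C. (\<lambda>x :: 'g \<Rightarrow> 'a. x k) -` {a. C k = Some a})"
    using assms by (intro open_INT ballI open_vimage) (auto intro: discrete_topology_class.open_discrete)
  moreover have "closed (\<Inter>k\<in>dom C. (\<lambda>x :: 'g \<Rightarrow> 'a. x k) -` {a. C k = Some a})"
    by (intro closed_INT ballI closed_vimage) (auto simp: closed_def intro: discrete_topology_class.open_discrete)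
  ultimately show ?thesis unfolding clopens_def eq by (auto intro: openin_open_Int closedin_closed_Int)
qed

lemma open_contains_cylinder:
  fixes U :: "('g \<Rightarrow> 'a::topological_space) set"
  assumes "open U" "x \<in> U" "x \<in> X"
  obtains C where "finite (dom C)" "x \<in> cylinder X C" "cylinder X C \<subseteq> U"
proof -
  have "openin (product_topology (\<lambda>_::'g. euclidean :: 'a topology) UNIV) U"
    using assms(1) by (simp add: euclidean_product_topology)
  from product_topology_open_contains_basis[OF this assms(2)]
  obtain V where V: "x \<in> PiE UNIV V" "finite {i. V i \<noteq> (UNIV :: 'a set)}" "PiE UNIV V \<subseteq> U"
    by auto
  let ?C = "restr x {i. V i \<noteq> UNIV}"
  have dom: "dom ?C = {i. V i \<noteq> UNIV}" by (auto simp: restr_def)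
  have "cylinder X ?C \<subseteq> PiE UNIV V"
  proof
    fix y assume "y \<in> cylinder X ?C"
    then have "y i = x i" if "V i \<noteq> UNIV" for i
      using that unfolding cylinder_eq dom by (auto simp: restr_def)
    then have "y i \<in> V i" for i using V(1) by (cases "V i = UNIV") (auto simp: PiE_def)
    then show "y \<in> PiE UNIV V" by auto
  qed
  with V(3) have "cylinder X ?C \<subseteq> U" by (rule order.trans[rotated])
  moreover have "x \<in> cylinder X ?C"
    using assms(3) unfolding cylinder_eq dom by (simp add: restr_def)
  moreover have "finite (dom ?C)" unfolding dom by (rule V(2))
  ultimately show ?thesis by (intro that)
qed

lemma countable_cylinders:
  fixes X :: "('g::countable \<Rightarrow> 'a::finite) set"
  shows "countable {cylinder X C |C. finite (dom C)}"
proof -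
  \<comment> \<open>Identifying a finite block with its graph turns it into a finite subset of a
    countable set.\<close>
  let ?graph = "\<lambda>C. {(k, a). C k = Some a} :: ('g \<times> 'a) set"
  have "finite (?graph C)" if "finite (dom C)" for C
    by (rule finite_subset[of _ "dom C \<times> UNIV"]) (use that in auto)
  then have "countable (?graph ` {C. finite (dom C)})"
    by (intro countable_subset[OF _ countable_Collect_finite]) auto
  moreover have "inj_on ?graph {C. finite (dom C)}"
  proof (rule inj_onI)
    fix C D :: "'g \<rightharpoonup> 'a" assume "?graph C = ?graph D"
    then have "C k = Some a \<longleftrightarrow> D k = Some a" for k a by (auto simp: set_eq_iff)
    then show "C = D" by (metis ext not_Some_eq)
  qed
  ultimately have "countable {C :: 'g \<rightharpoonup> 'a. finite (dom C)}"
    by (rule countable_image_inj_on)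
  then show ?thesis unfolding setcompr_eq_image by (rule countable_image)
qed

lemma open_eq_Union_cylinders:
  fixes U :: "('g \<Rightarrow> 'a::topological_space) set"
  assumes "open U"
  shows "X \<inter> U = \<Union>{c \<in> {cylinder X C |C. finite (dom C)}. c \<subseteq> U}"
proof
  show "X \<inter> U \<subseteq> \<Union>{c \<in> {cylinder X C |C. finite (dom C)}. c \<subseteq> U}"
  proof
    fix x assume "x \<in> X \<inter> U"
    then obtain C where "finite (dom C)" "x \<in> cylinder X C" "cylinder X C \<subseteq> U"
      using open_contains_cylinder[OF assms] by auto
    then show "x \<in> \<Union>{c \<in> {cylinder X C |C. finite (dom C)}. c \<subseteq> U}" by auto
  qed
qed (auto simp: cylinder_def)

text \<open>By compactness a clopen set is a finite union of cylinders, and there are only countably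
  many of those.\<close>

lemma countable_clopens:
  fixes X :: "('g::countable \<Rightarrow> 'a::{finite, discrete_topology}) set"
  assumes "closed X"
  shows "countable (clopens X)"
proof -
  define \<C> where "\<C> = {cylinder X C |C. finite (dom C)}"
  \<comment> \<open>Cylinders are open only relative to \<open>X\<close>, while the compactness rule
    wants open sets of the whole space; hence the choice of \<open>V\<close>.\<close>
  have "\<forall>c\<in>\<C>. \<exists>V. open V \<and> c = X \<inter> V"
    using cylinder_clopen[of _ X] by (auto simp: \<C>_def clopens_def openin_open)
  from bchoice[OF this] obtain V where V: "\<And>c. c \<in> \<C> \<Longrightarrow> open (V c)" "\<And>c. c \<in> \<C> \<Longrightarrow> c = X \<inter> V c"
    by auto
  have "clopens X \<subseteq> Union ` {\<A>. finite \<A> \<and> \<A> \<subseteq> \<C>}"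
  proof
    fix A assume A: "A \<in> clopens X"
    then obtain U where U: "open U" "A = X \<inter> U"
      by (auto simp: clopens_def openin_open)
    have "compact A"
      using A compact_closed_configurations[OF assms] by (auto simp: clopens_def intro: closedin_compact)
    moreover have eq: "A = \<Union>{c \<in> \<C>. c \<subseteq> U}"
      using open_eq_Union_cylinders[OF U(1), of X] U(2) by (simp add: \<C>_def)
    have "c \<subseteq> V c" if "c \<in> \<C>" for c
      using V(2)[OF that] by (metis inf_le2)
    then have "\<Union>{c \<in> \<C>. c \<subseteq> U} \<subseteq> (\<Union>c\<in>{c \<in> \<C>. c \<subseteq> U}. V c)" by fast
    ultimately obtain \<A> where \<A>: "\<A> \<subseteq> {c \<in> \<C>. c \<subseteq> U}" "finite \<A>" "A \<subseteq> (\<Union>c\<in>\<A>. V c)"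
      using compactE_image[of A "{c \<in> \<C>. c \<subseteq> U}" V] V(1) eq by auto
    have "A \<subseteq> \<Union>\<A>"
    proof
      fix x assume "x \<in> A"
      then obtain c where "c \<in> \<A>" "x \<in> X \<inter> V c" using \<A>(3) U(2) by auto
      then show "x \<in> \<Union>\<A>" using V(2)[of c] \<A>(1) by auto
    qed
    moreover have "\<Union>\<A> \<subseteq> A" unfolding eq using \<A>(1) by auto
    ultimately have "A = \<Union>\<A>" "\<A> \<in> {\<A>. finite \<A> \<and> \<A> \<subseteq> \<C>}" using \<A> by auto
    then show "A \<in> Union ` {\<A>. finite \<A> \<and> \<A> \<subseteq> \<C>}" by (rule image_eqI)
  qed
  moreover have "countable {\<A>. finite \<A> \<and> \<A> \<subseteq> \<C>}"
    unfolding \<C>_def by (rule countable_Collect_finite_subset[OF countable_cylinders])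
  ultimately show ?thesis by (meson countable_image countable_subset)
qed

text \<open>The countably many cylinders form a base, so relatively open sets are countable unions
  of clopen ones.\<close>

lemma sets_restrict_borel_clopens:
  fixes X :: "('g::countable \<Rightarrow> 'a::{finite, discrete_topology}) set"
  shows "sets (restrict_space borel X) = sigma_sets X (clopens X)"
proof
  have "X \<inter> B \<in> sigma_sets X (clopens X)" if "B \<in> sigma_sets UNIV {U. open U}" for B
    using that
  proof induction
    case (Basic U)
    then have "X \<inter> U = \<Union>{c \<in> {cylinder X C |C. finite (dom C)}. c \<subseteq> U}"
      using open_eq_Union_cylinders[of U X] by simp
    also have "\<dots> \<in> sigma_sets X (clopens X)"
      by (rule sigma_sets_UNION[OF countable_subset[OF _ countable_cylinders[of X]]])
        (auto intro: sigma_sets.Basic cylinder_clopen)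
    finally show ?case .
  next
    case (Compl B)
    have "X \<inter> (UNIV - B) = X - X \<inter> B" by auto
    with Compl show ?case by (auto intro: sigma_sets.Compl)
  next
    case (Union B)
    have "X \<inter> (\<Union>i. B i) = (\<Union>i. X \<inter> B i)" by auto
    with Union show ?case using sigma_sets.Union[of "\<lambda>i. X \<inter> B i"] by simp
  qed (auto intro: sigma_sets.Empty)
  moreover have "sets (borel :: ('g \<Rightarrow> 'a) measure) = sigma_sets UNIV {U. open U}"
    unfolding borel_def by simp
  ultimately show "sets (restrict_space borel X) \<subseteq> sigma_sets X (clopens X)"
    unfolding sets_restrict_space by (simp add: image_subset_iff)
  have "clopens X \<subseteq> sets (restrict_space borel X)"
  proof
    fix A assume "A \<in> clopens X"
    then obtain U where "open U" "A = X \<inter> U" by (auto simp: clopens_def openin_open)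
    then show "A \<in> sets (restrict_space borel X)"
      unfolding sets_restrict_space by (intro image_eqI[of _ _ U] borel_open)
  qed
  then show "sigma_sets X (clopens X) \<subseteq> sets (restrict_space borel X)"
    using sets.sigma_sets_subset[of "clopens X" "restrict_space borel X"]
    by (simp add: space_restrict_space)
qed

text \<open>By compactness, finite additivity on the clopen sets implies continuity at the empty set.\<close>

lemma fin_additive_extends_to_measure:
  fixes X :: "('g::countable \<Rightarrow> 'a::{finite, discrete_topology}) set"
  assumes "closed X" "fin_additive q"
  obtains M where "finite_measure M" "space M = X" "sets M = sets (restrict_space borel X)"
    "\<And>A. A \<in> clopens X \<Longrightarrow> measure M A = q A"
proof -
  interpret algebra X "clopens X" by (rule algebra_clopens)
  have "\<exists>\<mu>. (\<forall>A\<in>clopens X. \<mu> A = ennreal (q A)) \<and> measure_space X (sigma_sets X (clopens X)) \<mu>"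
  proof (rule caratheodory_empty_continuous)
    show "positive (clopens X) (\<lambda>A. ennreal (q A))"
      using fin_additive_empty[OF assms(2)] by (simp add: positive_def)
    show "additive (clopens X) (\<lambda>A. ennreal (q A))"
      using fin_additive_nonneg[OF assms(2)] fin_additive_Un[OF assms(2)]
      by (auto simp: additive_def ennreal_plus)
    fix A :: "nat \<Rightarrow> ('g \<Rightarrow> 'a) set"
    assume A: "range A \<subseteq> clopens X" "decseq A" "(\<Inter>i. A i) = {}"
    have "\<exists>N. A N = {}"
    proof (rule ccontr)
      assume "\<nexists>N. A N = {}"
      then have ne: "A N \<noteq> {}" for N by simp
      have cl: "closed (A i)" for i
        using A(1) assms(1) by (auto simp: clopens_def intro: closedin_closed_trans)
      have fip: "X \<inter> (\<Inter>i\<in>I. A i) \<noteq> {}" if I: "finite I" for I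
      proof -
        obtain n where n: "\<forall>i\<in>I. i \<le> n" using I unfolding finite_nat_set_iff_bounded_le ..
        have "A n \<subseteq> A i" if "i \<in> I" for i
          by (rule decseqD[OF A(2)]) (use n that in simp)
        then have "A n \<subseteq> (\<Inter>i\<in>I. A i)" by (rule INT_greatest)
        moreover have "A n \<subseteq> X" using A(1) by (intro clopens_subset) auto
        moreover have "A n \<noteq> {}" using ne by simp
        ultimately show ?thesis by (metis le_inf_iff subset_empty)
      qed
      have "X \<inter> (\<Inter>i\<in>UNIV. A i) \<noteq> {}"
        by (rule compact_imp_fip_image[OF compact_closed_configurations[OF assms(1)] cl fip])
      with A(3) show False by simp
    qed
    then obtain N where N: "A N = {}" ..
    have "A n = {}" if "n \<ge> N" for n using decseqD[OF A(2) that] N by simp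
    then have "\<forall>\<^sub>F n in sequentially. ennreal (q (A n)) = 0"
      using fin_additive_empty[OF assms(2)] by (intro eventually_sequentiallyI[of N]) simp
    then show "(\<lambda>n. ennreal (q (A n))) \<longlonglongrightarrow> 0" by (rule tendsto_eventually)
  qed simp
  then obtain \<mu> where \<mu>: "\<And>A. A \<in> clopens X \<Longrightarrow> \<mu> A = ennreal (q A)"
    "measure_space X (sigma_sets X (clopens X)) \<mu>" by blast
  define M where "M = measure_of X (sigma_sets X (clopens X)) \<mu>"
  have sub: "sigma_sets X (clopens X) \<subseteq> Pow X"
    using space_closed by (metis sigma_sets_into_sp PowI subsetI)
  have M: "space M = X" "sets M = sets (restrict_space borel X)"
    unfolding M_def sets_restrict_borel_clopens using sub
    by (simp_all add: space_measure_of sets_measure_of sigma_sets_sigma_sets_eq space_closed)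
  have em: "emeasure M A = ennreal (q A)" if "A \<in> clopens X" for A
    unfolding M_def using \<mu> that
    by (subst emeasure_measure_of_sigma) (auto simp: measure_space_def)
  have "finite_measure M"
    by (rule finite_measureI) (use em[OF top] M in simp)
  moreover have "measure M A = q A" if "A \<in> clopens X" for A
    using em[OF that] fin_additive_nonneg[OF assms(2)] by (simp add: measure_def)
  ultimately show ?thesis using M that by blast
qed

section \<open>Approximation of Borel sets by clopen sets\<close>

text \<open>Finite mass instead of mass 1, because measures dominated by a probability measure occur
  as well.\<close>

definition finite_borel_on :: "'b::topological_space set \<Rightarrow> 'b measure \<Rightarrow> bool" where
  "finite_borel_on X M \<longleftrightarrow> finite_measure M \<and> space M = X \<and> sets M = sets (restrict_space borel X)"

lemma finite_borel_onD:
  assumes "finite_borel_on X M"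
  shows "finite_measure M" "space M = X" "sets M = sets (restrict_space borel X)"
  using assms by (auto simp: finite_borel_on_def)

lemma finite_borel_on_prob: "\<mu> \<in> prob_measures X \<Longrightarrow> finite_borel_on X \<mu>"
  by (auto simp: prob_measures_def finite_borel_on_def intro: prob_space.finite_measure)

lemma clopens_in_sets:
  fixes X :: "('g::countable \<Rightarrow> 'a::{finite, discrete_topology}) set"
  assumes "finite_borel_on X M" "A \<in> clopens X"
  shows "A \<in> sets M"
  using assms by (auto simp: finite_borel_on_def sets_restrict_borel_clopens)

text \<open>The union step of the approximation, for one measure at a time: half of \<open>e\<close>
  pays for the tail of the union, and each of the first \<open>n\<close> sets costs at most
  \<open>e / (2 * n)\<close>. The sets \<open>B i\<close> are given, so that the same ones can serve
  a second measure.\<close>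

lemma clopens_approximate_finite_unions:
  fixes X :: "('g::countable \<Rightarrow> 'a::{finite, discrete_topology}) set"
    and B :: "nat \<Rightarrow> ('g \<Rightarrow> 'a) set" and n :: nat
  assumes M: "finite_borel_on X M" and A: "range A \<subseteq> sets M"
    and B: "\<And>i. i < n \<Longrightarrow> B i \<in> clopens X"
    and close: "\<And>i. i < n \<Longrightarrow> measure M ((A i - B i) \<union> (B i - A i)) \<le> e / (2 * n)"
    and tail: "measure M (\<Union>i. A i) - measure M (\<Union>i<n. A i) < e / 2"
    and e: "e > 0"
  shows "measure M (((\<Union>i. A i) - (\<Union>i<n. B i)) \<union> ((\<Union>i<n. B i) - (\<Union>i. A i))) < e"
proof -
  interpret finite_measure M using M by (rule finite_borel_onD)
  have AS[measurable]: "A i \<in> sets M" for i using A by auto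
  have BS[measurable]: "i < n \<Longrightarrow> B i \<in> sets M" for i using B clopens_in_sets[OF M] by auto
  let ?T = "(\<Union>i. A i) - (\<Union>i<n. A i)" and ?D = "\<lambda>i. (A i - B i) \<union> (B i - A i)"
  have "measure M (((\<Union>i. A i) - (\<Union>i<n. B i)) \<union> ((\<Union>i<n. B i) - (\<Union>i. A i))) \<le> measure M (?T \<union> (\<Union>i<n. ?D i))"
    by (intro finite_measure_mono sets.Un sets.Diff sets.finite_UN sets.countable_UN) (auto intro: AS BS)
  also have "\<dots> \<le> measure M ?T + measure M (\<Union>i<n. ?D i)"
    by (intro measure_Un_le sets.Un sets.Diff sets.finite_UN sets.countable_UN) (auto intro: AS BS)
  also have "measure M ?T = measure M (\<Union>i. A i) - measure M (\<Union>i<n. A i)"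
    by (intro finite_measure_Diff sets.finite_UN sets.countable_UN) (auto intro: AS)
  also have "measure M (\<Union>i<n. ?D i) \<le> (\<Sum>i<n. measure M (?D i))"
    by (intro measure_UNION_le) (auto intro!: sets.Un sets.Diff AS BS)
  also have "\<dots> \<le> (\<Sum>i<n. e / (2 * n))" by (intro sum_mono close) auto
  also have "\<dots> \<le> e / 2" using e by (simp add: field_simps)
  finally show ?thesis using tail by linarith
qed

text \<open>Induction over the generated \<sigma>-algebra. One clopen set has to serve both measures
  at once, since a comparison of \<open>M\<close> with \<open>N\<close> passes from one to the other
  through it.\<close>

lemma clopens_approximate:
  fixes X :: "('g::countable \<Rightarrow> 'a::{finite, discrete_topology}) set"
  assumes M: "finite_borel_on X M" and N: "finite_borel_on X N" and A: "A \<in> sets M" and e: "e > 0"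
  shows "\<exists>B\<in>clopens X. measure M ((A - B) \<union> (B - A)) < e \<and> measure N ((A - B) \<union> (B - A)) < e"
proof -
  interpret algebra X "clopens X" by (rule algebra_clopens)
  interpret M: finite_measure M using M by (rule finite_borel_onD)
  interpret N: finite_measure N using N by (rule finite_borel_onD)
  have setsM: "sets M = sigma_sets X (clopens X)"
    using M by (simp add: finite_borel_on_def sets_restrict_borel_clopens)
  have setsN: "sets N = sets M" using M N by (simp add: finite_borel_on_def)
  have "A \<in> sigma_sets X (clopens X)" using A setsM by simp
  then show ?thesis using e
  proof (induction arbitrary: e)
    case (Basic A)
    then show ?case by (intro bexI[of _ A]) auto
  next
    case Empty
    then show ?case by (intro bexI[of _ "{}"]) auto
  next
    case (Compl A)
    then obtain B where B: "B \<in> clopens X" "measure M ((A - B) \<union> (B - A)) < e"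
      "measure N ((A - B) \<union> (B - A)) < e" by blast
    have "A \<subseteq> X" using Compl.hyps by (rule sigma_sets_into_sp[OF space_closed])
    moreover have "B \<subseteq> X" using B(1) by (rule clopens_subset)
    ultimately have "((X - A) - (X - B)) \<union> ((X - B) - (X - A)) = (A - B) \<union> (B - A)" by auto
    with B compl_sets[OF B(1)] show ?case by (intro bexI[of _ "X - B"]) auto
  next
    case (Union A)
    have AS: "range A \<subseteq> sets M" using Union.hyps setsM by auto
    have inc: "incseq (\<lambda>n. \<Union>i<n. A i)"
      unfolding incseq_def by (intro allI impI UN_mono) auto
    have "(\<lambda>n. measure M (\<Union>i<n. A i)) \<longlonglongrightarrow> measure M (\<Union>n. \<Union>i<n. A i)"
      using AS by (intro M.finite_Lim_measure_incseq inc) auto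
    moreover have "(\<lambda>n. measure N (\<Union>i<n. A i)) \<longlonglongrightarrow> measure N (\<Union>n. \<Union>i<n. A i)"
      using AS by (intro N.finite_Lim_measure_incseq inc) (auto simp: setsN)
    moreover have UN: "(\<Union>n. \<Union>i<n. A i) = (\<Union>i. A i)" by (auto intro: lessI)
    ultimately have "\<forall>\<^sub>F n in sequentially. measure M (\<Union>i. A i) - e / 2 < measure M (\<Union>i<n. A i) \<and>
        measure N (\<Union>i. A i) - e / 2 < measure N (\<Union>i<n. A i)"
      using Union.prems by (intro eventually_conj order_tendstoD(1)) auto
    \<comment> \<open>\<open>Suc n\<close> secures a positive number of sets, so that
      \<open>e / (2 * n)\<close> is positive below.\<close>
    then have "\<exists>n. measure M (\<Union>i. A i) - e / 2 < measure M (\<Union>i<Suc n. A i) \<and>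
        measure N (\<Union>i. A i) - e / 2 < measure N (\<Union>i<Suc n. A i)"
      unfolding eventually_sequentially by (meson le_SucI order_refl)
    then obtain n where n: "n > 0" "measure M (\<Union>i. A i) - measure M (\<Union>i<n. A i) < e / 2"
      "measure N (\<Union>i. A i) - measure N (\<Union>i<n. A i) < e / 2"
      by (smt (verit) zero_less_Suc)
    then have "e / (2 * real n) > 0" using Union.prems by simp
    from Union.IH[OF this] obtain B where B: "\<And>i. B i \<in> clopens X"
      "\<And>i. measure M ((A i - B i) \<union> (B i - A i)) < e / (2 * real n)"
      "\<And>i. measure N ((A i - B i) \<union> (B i - A i)) < e / (2 * real n)" by metis
    show ?case
    proof (intro bexI[of _ "\<Union>i<n. B i"] conjI)
      show "(\<Union>i<n. B i) \<in> clopens X" using B(1) by (intro finite_UN) auto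
      show "measure M ((\<Union> (range A) - (\<Union>i<n. B i)) \<union> ((\<Union>i<n. B i) - \<Union> (range A))) < e"
        using AS B n Union.prems by (intro clopens_approximate_finite_unions[OF M]) (auto intro: less_imp_le)
      show "measure N ((\<Union> (range A) - (\<Union>i<n. B i)) \<union> ((\<Union>i<n. B i) - \<Union> (range A))) < e"
        using AS B n Union.prems
        by (intro clopens_approximate_finite_unions[OF N]) (auto simp: setsN intro: less_imp_le)
    qed
  qed
qed

lemma (in finite_measure) measure_le_add_symdiff:
  assumes "A \<in> sets M" "B \<in> sets M"
  shows "measure M A \<le> measure M B + measure M ((A - B) \<union> (B - A))"
proof -
  have "measure M A \<le> measure M (B \<union> ((A - B) \<union> (B - A)))"
    using assms by (intro finite_measure_mono) auto
  also have "\<dots> \<le> measure M B + measure M ((A - B) \<union> (B - A))"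
    using assms by (intro measure_Un_le) auto
  finally show ?thesis .
qed

text \<open>The chain runs from \<open>M A\<close> over \<open>M B\<close> and \<open>N B\<close> to
  \<open>N A\<close>, with \<open>B\<close> clopen and close to \<open>A\<close> for both
  measures.\<close>

lemma measure_mono_from_clopens:
  fixes X :: "('g::countable \<Rightarrow> 'a::{finite, discrete_topology}) set"
  assumes M: "finite_borel_on X M" and N: "finite_borel_on X N"
    and le: "\<And>A. A \<in> clopens X \<Longrightarrow> measure M A \<le> measure N A" and A: "A \<in> sets M"
  shows "measure M A \<le> measure N A"
proof (rule field_le_epsilon)
  interpret M: finite_measure M using M by (rule finite_borel_onD)
  interpret N: finite_measure N using N by (rule finite_borel_onD)
  fix e :: real assume "e > 0"
  then obtain B where B: "B \<in> clopens X" "measure M ((A - B) \<union> (B - A)) < e / 2"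
    "measure N ((A - B) \<union> (B - A)) < e / 2"
    using clopens_approximate[OF M N A, of "e / 2"] by auto
  have A': "A \<in> sets N" using A M N by (simp add: finite_borel_on_def)
  have "measure M A \<le> measure M B + measure M ((A - B) \<union> (B - A))"
    by (intro M.measure_le_add_symdiff A clopens_in_sets[OF M] B)
  also have "measure M B \<le> measure N B" by (rule le[OF B(1)])
  also have "measure N B \<le> measure N A + measure N ((A - B) \<union> (B - A))"
    using N.measure_le_add_symdiff[OF clopens_in_sets[OF N B(1)] A'] by (simp add: Un_commute)
  finally show "measure M A \<le> measure N A + e" using B by simp
qed

lemma measure_eqI_clopens:
  fixes X :: "('g::countable \<Rightarrow> 'a::{finite, discrete_topology}) set"
  assumes M: "finite_borel_on X M" and N: "finite_borel_on X N"
    and eq: "\<And>A. A \<in> clopens X \<Longrightarrow> measure M A = measure N A"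
  shows "M = N"
proof (rule measure_eqI)
  show "sets M = sets N" using M N by (simp add: finite_borel_on_def)
  fix A assume "A \<in> sets M"
  then have "measure M A = measure N A"
    using measure_mono_from_clopens[OF M N] measure_mono_from_clopens[OF N M] eq \<open>sets M = sets N\<close>
    by (metis order.antisym order.refl)
  then show "emeasure M A = emeasure N A"
    using finite_borel_onD(1)[OF M] finite_borel_onD(1)[OF N]
    by (simp add: finite_measure.emeasure_eq_measure)
qed

section \<open>Shifts and invariant measures\<close>

lemma shift_shift: "shift g (shift h x) = shift (g + h) x"
  by (simp add: shift_def add.assoc)

lemma shift_0: "shift 0 x = x"
  by (simp add: shift_def)

lemma shift_vimage_clopens:
  fixes X :: "('g::{group_add, countable} \<Rightarrow> 'a::{finite, discrete_topology}) set"
  assumes "subshift X" "A \<in> clopens X"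
  shows "shift g -` A \<inter> X \<in> clopens X"
proof -
  have "continuous_on X (shift g :: ('g \<Rightarrow> 'a) \<Rightarrow> _)"
    unfolding shift_def
    by (rule continuous_on_coordinatewise_then_product)
      (rule continuous_on_subset[OF continuous_on_product_coordinates subset_UNIV])
  moreover have "shift g \<in> X \<rightarrow> X" using assms(1) by (auto simp: subshift_def)
  ultimately have "openin (top_of_set X) (X \<inter> shift g -` A)" "closedin (top_of_set X) (X \<inter> shift g -` A)"
    using assms(2) by (auto simp: clopens_def intro: continuous_openin_preimage continuous_closedin_preimage_gen)
  then show ?thesis by (simp add: clopens_def Int_commute)
qed

lemma shift_measurable:
  fixes X :: "('g::{group_add, countable} \<Rightarrow> 'a::{finite, discrete_topology}) set"
  assumes "subshift X" "finite_borel_on X M"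
  shows "shift g \<in> measurable M M"
proof (rule measurable_sigma_sets)
  show "sets M = sigma_sets X (clopens X)"
    using assms by (simp add: finite_borel_on_def sets_restrict_borel_clopens)
  show "clopens X \<subseteq> Pow X" using clopens_subset by auto
  show "shift g \<in> space M \<rightarrow> X"
    using assms by (auto simp: finite_borel_on_def subshift_def)
  show "shift g -` A \<inter> space M \<in> sets M" if "A \<in> clopens X" for A
    using shift_vimage_clopens[OF assms(1) that] clopens_in_sets[OF assms(2)] assms(2)
    by (simp add: finite_borel_on_def)
qed

lemma shift_invariantI:
  fixes X :: "('g::{group_add, countable} \<Rightarrow> 'a::{finite, discrete_topology}) set"
  assumes X: "subshift X" and M: "finite_borel_on X M"
    and eq: "\<And>A. A \<in> clopens X \<Longrightarrow> measure M (shift g -` A \<inter> X) = measure M A"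
  shows "distr M M (shift g) = M"
proof (rule measure_eqI_clopens[OF _ M])
  have meas: "shift g \<in> measurable M M" by (rule shift_measurable[OF X M])
  show "finite_borel_on X (distr M M (shift g))"
    using M finite_measure.finite_measure_distr[OF finite_borel_onD(1)[OF M] meas]
    by (simp add: finite_borel_on_def)
  show "measure (distr M M (shift g)) A = measure M A" if "A \<in> clopens X" for A
    using eq[OF that] measure_distr[OF meas clopens_in_sets[OF M that]] finite_borel_onD(2)[OF M] by simp
qed

lemma measure_shift_vimage:
  fixes X :: "('g::{group_add, countable} \<Rightarrow> 'a::{finite, discrete_topology}) set"
  assumes "subshift X" "finite_borel_on X M" "distr M M (shift g) = M" "A \<in> sets M"
  shows "measure M (shift g -` A \<inter> X) = measure M A"
  using measure_distr[OF shift_measurable[OF assms(1,2)] assms(4), of g] assms(3) finite_borel_onD(2)[OF assms(2)]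
  by simp

section \<open>Weak-star limits tested on clopen sets\<close>

text \<open>Cylinders form a base and \<open>X\<close> is compact, so finitely many cylinders of
  small oscillation cover \<open>X\<close>. Made disjoint, they turn \<open>f\<close> into a clopen
  step function up to a uniform error.\<close>

lemma clopen_partition_oscillation:
  fixes X :: "('g::countable \<Rightarrow> 'a::{finite, discrete_topology}) set" and f :: "('g \<Rightarrow> 'a) \<Rightarrow> real"
  assumes X: "closed X" and f: "continuous_on X f" and e: "e > 0"
  obtains n :: nat and B :: "nat \<Rightarrow> ('g \<Rightarrow> 'a) set" and c :: "nat \<Rightarrow> real"
  where "\<And>i. B i \<in> clopens X" "disjoint_family B" "X = (\<Union>i<n. B i)"
    "\<And>i x. x \<in> B i \<Longrightarrow> \<bar>f x - c i\<bar> < e"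
proof -
  interpret algebra X "clopens X" by (rule algebra_clopens)
  have "\<exists>A V. A \<in> clopens X \<and> x \<in> A \<and> (\<forall>y\<in>A. \<bar>f y - f x\<bar> < e) \<and> open V \<and> A = X \<inter> V" if x: "x \<in> X" for x
  proof -
    obtain U where U: "open U" "U \<inter> X = f -` ball (f x) e \<inter> X"
      using f[unfolded continuous_on_open_invariant] open_ball by metis
    have "x \<in> U" using U(2) x e by auto
    from open_contains_cylinder[OF U(1) this x] obtain C where C: "finite (dom C)"
      "x \<in> cylinder X C" "cylinder X C \<subseteq> U" .
    have "\<forall>y\<in>cylinder X C. \<bar>f y - f x\<bar> < e"
    proof
      fix y assume "y \<in> cylinder X C"
      then have "y \<in> U \<inter> X" using C(3) by (auto simp: cylinder_def)
      then show "\<bar>f y - f x\<bar> < e" unfolding U(2) by (simp add: dist_real_def abs_minus_commute)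
    qed
    moreover have cl: "cylinder X C \<in> clopens X" by (rule cylinder_clopen[OF C(1)])
    moreover obtain V where "open V" "cylinder X C = X \<inter> V"
      using cl unfolding clopens_def openin_open by blast
    ultimately show ?thesis using C(2) by (intro exI[of _ "cylinder X C"] exI[of _ V] conjI)
  qed
  then obtain A V where A: "\<And>x. x \<in> X \<Longrightarrow> A x \<in> clopens X" "\<And>x. x \<in> X \<Longrightarrow> x \<in> A x"
    "\<And>x y. x \<in> X \<Longrightarrow> y \<in> A x \<Longrightarrow> \<bar>f y - f x\<bar> < e"
    and V: "\<And>x. x \<in> X \<Longrightarrow> open (V x)" "\<And>x. x \<in> X \<Longrightarrow> A x = X \<inter> V x" by metis
  have "X \<subseteq> (\<Union>x\<in>X. V x)" using A(2) V(2) by auto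
  then obtain I where I: "I \<subseteq> X" "finite I" "X \<subseteq> (\<Union>x\<in>I. V x)"
    using compactE_image[OF compact_closed_configurations[OF X], of X V] V(1) by auto
  obtain p and n :: nat where p: "I = p ` {i. i < n}"
    using finite_imp_nat_seg_image_inj_on[OF I(2)] by auto
  \<comment> \<open>Padding with empty sets gives an infinite sequence, as \<open>disjointed\<close>
    requires, and makes the oscillation claim vacuous beyond \<open>n\<close>.\<close>
  define A' where "A' i = (if i < n then A (p i) else {})" for i
  have pX: "p i \<in> X" if "i < n" for i using that p I(1) by auto
  have A'_clopen: "A' i \<in> clopens X" for i using A(1) pX by (auto simp: A'_def)
  show ?thesis
  proof (rule that[of "disjointed A'" n "\<lambda>i. f (p i)"])
    show "disjointed A' i \<in> clopens X" for i
      unfolding disjointed_def using A'_clopen by (intro Diff finite_UN) auto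
    show "disjoint_family (disjointed A')" by (rule disjoint_family_disjointed)
    have "X = (\<Union>i\<in>{0..<n}. A' i)"
    proof
      show "X \<subseteq> (\<Union>i\<in>{0..<n}. A' i)"
      proof
        fix x assume x: "x \<in> X"
        then obtain i where "i < n" "x \<in> V (p i)" using I(3) p by auto
        then have "x \<in> A' i" using V(2)[OF pX] x by (simp add: A'_def)
        then show "x \<in> (\<Union>i\<in>{0..<n}. A' i)" using \<open>i < n\<close> by auto
      qed
      show "(\<Union>i\<in>{0..<n}. A' i) \<subseteq> X" using clopens_subset[OF A'_clopen] by (rule UN_least)
    qed
    then show "X = (\<Union>i<n. disjointed A' i)"
      unfolding lessThan_atLeast0 finite_UN_disjointed_eq .
    show "\<bar>f x - f (p i)\<bar> < e" if "x \<in> disjointed A' i" for i x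
    proof -
      have "x \<in> A' i" using that disjointed_subset by fast
      then have "i < n" "x \<in> A (p i)" by (simp_all add: A'_def split: if_splits)
      then show ?thesis by (intro A(3) pX)
    qed
  qed
qed

text \<open>A single step function approximates the integrals of \<open>f\<close> against all
  probability measures on \<open>X\<close> to within \<open>e / 3\<close>; convergence on clopen
  sets handles the step function itself.\<close>

lemma integral_tendsto_from_clopens:
  fixes X :: "('g::countable \<Rightarrow> 'a::{finite, discrete_topology}) set" and f :: "('g \<Rightarrow> 'a) \<Rightarrow> real"
  assumes X: "closed X" and f: "continuous_on X f"
    and M: "\<And>i. M i \<in> prob_measures X" and N: "N \<in> prob_measures X"
    and lim: "\<And>A. A \<in> clopens X \<Longrightarrow> ((\<lambda>i. measure (M i) A) \<longlongrightarrow> measure N A) F"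
  shows "((\<lambda>i. \<integral>x. f x \<partial>M i) \<longlongrightarrow> (\<integral>x. f x \<partial>N)) F"
proof (rule tendstoI)
  fix e :: real assume "e > 0"
  then have e3: "e / 3 > 0" by simp
  obtain n :: nat and B :: "nat \<Rightarrow> ('g \<Rightarrow> 'a) set" and c
    where B: "\<And>i. B i \<in> clopens X" "disjoint_family B" "X = (\<Union>i<n. B i)"
      and c: "\<And>i x. x \<in> B i \<Longrightarrow> \<bar>f x - c i\<bar> < e / 3"
    by (rule clopen_partition_oscillation[OF X f e3]) blast
  have approx: "\<bar>(\<integral>x. f x \<partial>L) - (\<Sum>i<n. c i * measure L (B i))\<bar> \<le> e / 3"
    if L: "L \<in> prob_measures X" for L
  proof -
    interpret prob_space L using L by (simp add: prob_measures_def)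
    have sp: "space L = X" and setsL: "sets L = sets (restrict_space borel X)"
      using L by (auto simp: prob_measures_def)
    have BL: "B i \<in> sets L" for i by (rule clopens_in_sets[OF finite_borel_on_prob[OF L] B(1)])
    have "f \<in> borel_measurable (restrict_space borel X)"
      by (rule borel_measurable_continuous_on_restrict[OF f])
    then have fL: "f \<in> borel_measurable L" using measurable_cong_sets[OF setsL refl] by blast
    define g where "g x = (\<Sum>i<n. c i * indicator (B i) x)" for x
    have g_eq: "g x = c i" if "x \<in> B i" "i < n" for x i
    proof -
      have "g x = (\<Sum>j<n. if j = i then c i else 0)"
        unfolding g_def using that B(2)
        by (intro sum.cong) (auto simp: disjoint_family_on_def indicator_def)
      then show ?thesis using that by simp
    qed
    have close: "\<bar>f x - g x\<bar> \<le> e / 3" if x: "x \<in> space L" for x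
    proof -
      obtain i where "i < n" "x \<in> B i" using x sp B(3) by auto
      then show ?thesis using c[of x i] g_eq by simp
    qed
    have int_g: "integrable L g"
      unfolding g_def using BL
      by (intro Bochner_Integration.integrable_sum integrable_mult_right) (auto simp: less_top[symmetric])
    have meas: "(\<lambda>x. f x - g x) \<in> borel_measurable L"
      using fL int_g by measurable
    have int_d: "integrable L (\<lambda>x. f x - g x)"
      using close meas by (intro integrable_const_bound[where B = "e / 3"]) auto
    have "integrable L (\<lambda>x. (f x - g x) + g x)" using int_d int_g by (rule Bochner_Integration.integrable_add)
    then have int_f: "integrable L f" by simp
    have "\<bar>\<integral>x. f x - g x \<partial>L\<bar> \<le> (\<integral>x. \<bar>f x - g x\<bar> \<partial>L)"
      using integral_norm_bound[of L "\<lambda>x. f x - g x"] by simp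
    also have "\<dots> \<le> (\<integral>x. e / 3 \<partial>L)"
      using int_d close by (intro integral_mono) auto
    also have "\<dots> = e / 3" by (simp add: prob_space)
    finally have "\<bar>(\<integral>x. f x \<partial>L) - (\<integral>x. g x \<partial>L)\<bar> \<le> e / 3"
      using int_f int_g by simp
    moreover have "(\<integral>x. g x \<partial>L) = (\<Sum>i<n. c i * measure L (B i))"
      unfolding g_def using BL
      by (subst Bochner_Integration.integral_sum) (auto simp: less_top[symmetric] sets.Int_space_eq2)
    ultimately show ?thesis by simp
  qed
  have "((\<lambda>i. \<Sum>k<n. c k * measure (M i) (B k)) \<longlongrightarrow> (\<Sum>k<n. c k * measure N (B k))) F"
    by (intro tendsto_sum tendsto_mult tendsto_const lim B)
  then have "\<forall>\<^sub>F i in F. dist (\<Sum>k<n. c k * measure (M i) (B k)) (\<Sum>k<n. c k * measure N (B k)) < e / 3"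
    using e3 by (rule tendstoD)
  then show "\<forall>\<^sub>F i in F. dist (\<integral>x. f x \<partial>M i) (\<integral>x. f x \<partial>N) < e"
  proof eventually_elim
    case (elim i)
    then show ?case using approx[OF M[of i]] approx[OF N] unfolding dist_real_def by linarith
  qed
qed

text \<open>\<open>weak_star\<close> is given by a subbase, so closedness is used through the
  complement: along \<open>F\<close> the measures enter every open set containing \<open>N\<close>,
  by induction on how that set is generated.\<close>

lemma weak_star_closed_limit:
  fixes X :: "('g::countable \<Rightarrow> 'a::{finite, discrete_topology}) set"
  assumes X: "closed X" and E: "closedin (weak_star X) E" "E \<subseteq> prob_measures X" and F: "F \<noteq> bot"
    and M: "\<And>i. M i \<in> E" and N: "N \<in> prob_measures X"
    and lim: "\<And>A. A \<in> clopens X \<Longrightarrow> ((\<lambda>i. measure (M i) A) \<longlongrightarrow> measure N A) F"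
  shows "N \<in> E"
proof (rule ccontr)
  let ?S = "{{\<mu> \<in> prob_measures X. (\<integral>x. f x \<partial>\<mu>) \<in> W} | (f :: ('g \<Rightarrow> 'a) \<Rightarrow> real) W.
        continuous_on X f \<and> open W}"
  assume "N \<notin> E"
  have M': "M i \<in> prob_measures X" for i using M E(2) by auto
  have ev: "\<forall>\<^sub>F i in F. M i \<in> O'" if "generate_topology_on ?S O'" "N \<in> O'" for O'
    using that
  proof induction
    case (Int a b)
    then show ?case by (auto intro: eventually_conj)
  next
    case (UN K)
    then obtain k where "k \<in> K" "N \<in> k" by auto
    from UN.IH[OF this] show ?case by eventually_elim (use \<open>k \<in> K\<close> in auto)
  next
    case (Basis s)
    from Basis(1) obtain f :: "('g \<Rightarrow> 'a) \<Rightarrow> real" and W where f: "continuous_on X f" and W: "open W"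
      and s: "s = {\<mu> \<in> prob_measures X. (\<integral>x. f x \<partial>\<mu>) \<in> W}"
      by blast
    have "((\<lambda>i. \<integral>x. f x \<partial>M i) \<longlongrightarrow> (\<integral>x. f x \<partial>N)) F"
      by (rule integral_tendsto_from_clopens[OF X f M' N lim])
    moreover have "(\<integral>x. f x \<partial>N) \<in> W" using Basis(2) unfolding s by simp
    ultimately have "\<forall>\<^sub>F i in F. (\<integral>x. f x \<partial>M i) \<in> W"
      using W by (intro topological_tendstoD)
    then show ?case unfolding s by eventually_elim (use M' in simp)
  qed simp
  have "N \<in> topspace (weak_star X)"
  proof -
    have "prob_measures X \<in> ?S"
      by (rule CollectI, rule exI[of _ "\<lambda>_. 0"], rule exI[of _ UNIV]) auto
    then show ?thesis unfolding weak_star_def using N by auto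
  qed
  moreover have "openin (weak_star X) (topspace (weak_star X) - E)"
    using E(1) by (simp add: closedin_def)
  then have "generate_topology_on ?S (topspace (weak_star X) - E)"
    unfolding weak_star_def by (rule openin_topology_generated_by)
  ultimately have "\<forall>\<^sub>F i in F. M i \<in> topspace (weak_star X) - E"
    using \<open>N \<notin> E\<close> by (intro ev) auto
  then have "\<forall>\<^sub>F i in F. False" by eventually_elim (use M in auto)
  with F show False by simp
qed

section \<open>Ergodic measures from extremal means\<close>

text \<open>A set \<open>A\<close> as in the failure of ergodicity, approximated by clopen sets, splits the mean \<open>m\<close> into the
  restrictions of \<open>m\<close> to \<open>{g. shift g x \<in> A}\<close> and its complement, although \<open>m\<close> is not countably additive.\<close>

lemma invariant_mean_split:
  fixes X :: "('g::{group_add, countable} \<Rightarrow> 'a::{finite, discrete_topology}) set"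
  assumes X: "subshift X" and x: "x \<in> X" and m: "invariant_mean m"
    and M: "finite_borel_on X \<mu>" and inv: "\<And>g. distr \<mu> \<mu> (shift g) = \<mu>"
    and eq: "\<And>A. A \<in> clopens X \<Longrightarrow> measure \<mu> A = m {g. shift g x \<in> A}"
    and A: "A \<in> sets \<mu>" "\<And>g. shift g -` A \<inter> X = A" "0 < measure \<mu> A" "measure \<mu> A < 1"
  obtains m\<^sub>1 m\<^sub>2 where "invariant_mean m\<^sub>1" "invariant_mean m\<^sub>2"
    "\<And>D. m D = measure \<mu> A * m\<^sub>1 D + (1 - measure \<mu> A) * m\<^sub>2 D"
    "\<And>B. B \<in> clopens X \<Longrightarrow> measure \<mu> A * m\<^sub>1 {g. shift g x \<in> B} = measure \<mu> (B \<inter> A)"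
proof -
  interpret finite_measure \<mu> using M by (rule finite_borel_onD)
  interpret algebra X "clopens X" by (rule algebra_clopens)
  have add: "fin_additive m" and one: "m UNIV = 1" and minv: "\<And>h D. m {g. h + g \<in> D} = m D"
    using m by (auto simp: invariant_mean_def)
  have sp: "space \<mu> = X" using M by (rule finite_borel_onD)
  let ?s = "measure \<mu> A"
  have "\<forall>n. \<exists>B\<in>clopens X. measure \<mu> ((A - B) \<union> (B - A)) < 1 / real (Suc n)"
    using clopens_approximate[OF M M A(1)] by simp
  then obtain B where B: "\<And>n. B n \<in> clopens X"
    and AB: "\<And>n. measure \<mu> ((A - B n) \<union> (B n - A)) < 1 / real (Suc n)" by metis
  have BS: "B n \<in> sets \<mu>" for n by (rule clopens_in_sets[OF M B])
  have lim0: "(\<lambda>n. 1 / real (Suc n)) \<longlonglongrightarrow> 0"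
    using LIMSEQ_inverse_real_of_nat by (simp add: inverse_eq_divide)
  have measure_lim: "(\<lambda>n. measure \<mu> (E \<inter> B n)) \<longlonglongrightarrow> measure \<mu> (E \<inter> A)" if E: "E \<in> sets \<mu>" for E
  proof -
    have "norm (measure \<mu> (E \<inter> B n) - measure \<mu> (E \<inter> A)) \<le> 1 / real (Suc n)" for n
    proof -
      have "measure \<mu> (E \<inter> B n) \<le> measure \<mu> (E \<inter> A) + measure \<mu> ((E \<inter> B n - E \<inter> A) \<union> (E \<inter> A - E \<inter> B n))"
        "measure \<mu> (E \<inter> A) \<le> measure \<mu> (E \<inter> B n) + measure \<mu> ((E \<inter> A - E \<inter> B n) \<union> (E \<inter> B n - E \<inter> A))"
        using E A(1) BS by (auto intro!: measure_le_add_symdiff)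
      moreover have "measure \<mu> ((E \<inter> B n - E \<inter> A) \<union> (E \<inter> A - E \<inter> B n)) \<le> measure \<mu> ((A - B n) \<union> (B n - A))"
        using A(1) BS by (intro finite_measure_mono) auto
      ultimately show ?thesis using AB[of n] by (simp add: Un_commute abs_le_iff)
    qed
    then have "(\<lambda>n. measure \<mu> (E \<inter> B n) - measure \<mu> (E \<inter> A)) \<longlonglongrightarrow> 0"
      by (intro Lim_null_comparison[OF _ lim0] always_eventually) auto
    then show ?thesis by (simp add: LIM_zero_iff)
  qed
  define D\<^sub>B where "D\<^sub>B n = {g. shift g x \<in> B n}" for n
  \<comment> \<open>The values on intersections with \<open>D\<^sub>B n\<close> need not converge,
    as \<open>m\<close> is not countably additive; a limit along a finer filter replaces the
    restriction. On orbit preimages of clopen sets it is determined by the measure.\<close>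
  obtain F a where F: "F \<noteq> bot" "F \<le> sequentially" and a: "\<And>D. ((\<lambda>n. m (D \<inter> D\<^sub>B n)) \<longlongrightarrow> a D) F"
    by (rule convergent_finer_filter[of sequentially "\<lambda>n D. m (D \<inter> D\<^sub>B n)"])
      (use fin_additive_nonneg[OF add] invariant_mean_le_1[OF m] in auto)
  have a_add: "fin_additive a"
  proof (rule fin_additive_limit[OF F(1) always_eventually a], rule allI)
    show "fin_additive (\<lambda>D. m (D \<inter> D\<^sub>B n))" for n
      using fin_additive_vimage[OF add, of "D\<^sub>B n" "\<lambda>g. g"] by (simp add: Int_commute)
  qed
  have a_le: "a D \<le> m D" for D
    by (rule tendsto_upperbound[OF a _ F(1)]) (auto intro!: always_eventually fin_additive_mono[OF add])
  \<comment> \<open>As \<open>A\<close> is invariant, \<open>B n\<close> and its shift preimage are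
    both within \<open>1 / Suc n\<close> of \<open>A\<close>, so exchanging them costs at most twice
    that.\<close>
  have a_inv: "a {g. h + g \<in> D} = a D" for h D
  proof -
    have bound: "norm (m ({g. h + g \<in> D} \<inter> D\<^sub>B n) - m (D \<inter> D\<^sub>B n)) \<le> 2 * (1 / real (Suc n))" for n
    proof -
      let ?B' = "shift h -` B n \<inter> X"
      have B'S: "?B' \<in> sets \<mu>" by (rule clopens_in_sets[OF M shift_vimage_clopens[OF X B]])
      have "{g. h + g \<in> D \<inter> D\<^sub>B n} = {g. h + g \<in> D} \<inter> {g. shift g x \<in> ?B'}"
        using X x by (auto simp: D\<^sub>B_def shift_shift subshift_def)
      then have "m (D \<inter> D\<^sub>B n) = m ({g. h + g \<in> D} \<inter> {g. shift g x \<in> ?B'})"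
        using minv[of h "D \<inter> D\<^sub>B n"] by simp
      then have "\<bar>m ({g. h + g \<in> D} \<inter> D\<^sub>B n) - m (D \<inter> D\<^sub>B n)\<bar>
          \<le> m ((D\<^sub>B n - {g. shift g x \<in> ?B'}) \<union> ({g. shift g x \<in> ?B'} - D\<^sub>B n))"
        using fin_additive_Int_diff_le[OF add] by simp
      also have "(D\<^sub>B n - {g. shift g x \<in> ?B'}) \<union> ({g. shift g x \<in> ?B'} - D\<^sub>B n)
          = {g. shift g x \<in> (B n - ?B') \<union> (?B' - B n)}"
        by (auto simp: D\<^sub>B_def)
      also have "m \<dots> = measure \<mu> ((B n - ?B') \<union> (?B' - B n))"
        using B shift_vimage_clopens[OF X B] by (intro eq[symmetric] Un Diff)
      also have "\<dots> \<le> measure \<mu> (((A - B n) \<union> (B n - A)) \<union> ((A - ?B') \<union> (?B' - A)))"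
        using A(1) BS B'S by (intro finite_measure_mono) auto
      also have "\<dots> \<le> measure \<mu> ((A - B n) \<union> (B n - A)) + measure \<mu> ((A - ?B') \<union> (?B' - A))"
        using A(1) BS B'S by (intro measure_Un_le) auto
      also have "(A - ?B') \<union> (?B' - A) = shift h -` ((A - B n) \<union> (B n - A)) \<inter> X"
        using A(2)[of h] by auto
      also have "measure \<mu> \<dots> = measure \<mu> ((A - B n) \<union> (B n - A))"
        using A(1) BS by (intro measure_shift_vimage[OF X M inv]) auto
      finally show ?thesis using AB[of n] by simp
    qed
    have "(\<lambda>n. 2 * (1 / real (Suc n))) \<longlonglongrightarrow> 0" using tendsto_mult_right_zero[OF lim0] .
    then have "((\<lambda>n. m ({g. h + g \<in> D} \<inter> D\<^sub>B n) - m (D \<inter> D\<^sub>B n)) \<longlongrightarrow> 0) F"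
      using bound by (intro Lim_null_comparison[OF _ tendsto_mono[OF F(2)]] always_eventually) auto
    with tendsto_diff[OF a a] show ?thesis using tendsto_unique[OF F(1)] by fastforce
  qed
  have a_clopen: "a {g. shift g x \<in> E} = measure \<mu> (E \<inter> A)" if E: "E \<in> clopens X" for E
  proof (rule tendsto_unique[OF F(1) a])
    have "m ({g. shift g x \<in> E} \<inter> D\<^sub>B n) = measure \<mu> (E \<inter> B n)" for n
      using eq[OF Int[OF E B[of n]]] by (simp add: D\<^sub>B_def Collect_conj_eq)
    then show "((\<lambda>n. m ({g. shift g x \<in> E} \<inter> D\<^sub>B n)) \<longlongrightarrow> measure \<mu> (E \<inter> A)) F"
      using tendsto_mono[OF F(2) measure_lim[OF clopens_in_sets[OF M E]]] by simp
  qed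
  have "{g. shift g x \<in> X} = UNIV" using X x by (auto simp: subshift_def)
  moreover have "X \<inter> A = A" using sets.sets_into_space[OF A(1)] sp by auto
  ultimately have a_one: "a UNIV = ?s" using a_clopen[OF top] by simp
  show ?thesis
  \<comment> \<open>\<open>a\<close> is the share of the mean belonging to \<open>A\<close> and has
    total mass \<open>?s\<close>; normalizing it and the remainder \<open>m - a\<close> gives the
    two means.\<close>
  proof (rule that[of "\<lambda>D. a D / ?s" "\<lambda>D. (m D - a D) / (1 - ?s)"])
    show "invariant_mean (\<lambda>D. a D / ?s)"
      using A(3) a_one a_inv fin_additive_nonneg[OF a_add] fin_additive_Un[OF a_add]
      by (simp add: invariant_mean_def fin_additive_def add_divide_distrib)
    show "invariant_mean (\<lambda>D. (m D - a D) / (1 - ?s))"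
      using A(4) a_one one a_inv minv a_le fin_additive_Un[OF a_add] fin_additive_Un[OF add]
      by (simp add: invariant_mean_def fin_additive_def add_divide_distrib[symmetric])
    show "m D = ?s * (a D / ?s) + (1 - ?s) * ((m D - a D) / (1 - ?s))" for D
      using A(3,4) by simp
    show "?s * (a {g. shift g x \<in> E} / ?s) = measure \<mu> (E \<inter> A)" if "E \<in> clopens X" for E
      using A(3) a_clopen[OF that] by simp
  qed
qed

text \<open>An invariant set of intermediate measure would split \<open>m\<close>. Extremality then
  makes this set independent of every clopen set, hence by approximation of itself, which forces
  measure 0 or 1.\<close>

lemma extremal_mean_ergodic:
  fixes X :: "('g::{group_add, countable} \<Rightarrow> 'a::{finite, discrete_topology}) set"
  assumes X: "subshift X" and x: "x \<in> X" and m: "invariant_mean m"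
    and extremal: "\<And>m\<^sub>1 m\<^sub>2 s A. invariant_mean m\<^sub>1 \<Longrightarrow> invariant_mean m\<^sub>2 \<Longrightarrow> 0 < s \<Longrightarrow> s < 1 \<Longrightarrow>
       (\<And>D. m D = s * m\<^sub>1 D + (1 - s) * m\<^sub>2 D) \<Longrightarrow> A \<in> clopens X \<Longrightarrow>
       m\<^sub>1 {g. shift g x \<in> A} = m {g. shift g x \<in> A}"
  obtains \<mu> where "\<mu> \<in> erg_measures X" "\<And>A. A \<in> clopens X \<Longrightarrow> measure \<mu> A = m {g. shift g x \<in> A}"
proof -
  interpret algebra X "clopens X" by (rule algebra_clopens)
  have add: "fin_additive m" and one: "m UNIV = 1" and minv: "\<And>h D. m {g. h + g \<in> D} = m D"
    using m by (auto simp: invariant_mean_def)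
  have orbit: "shift g x \<in> X" for g using X x by (auto simp: subshift_def)
  have "fin_additive (\<lambda>A. m {g. shift g x \<in> A})"
    using fin_additive_vimage[OF add, of UNIV "\<lambda>g. shift g x"] by simp
  from fin_additive_extends_to_measure[OF _ this, of X]
  obtain \<mu> where "finite_measure \<mu>" "space \<mu> = X" "sets \<mu> = sets (restrict_space borel X)"
    and eq: "\<And>A. A \<in> clopens X \<Longrightarrow> measure \<mu> A = m {g. shift g x \<in> A}"
    using X by (auto simp: subshift_def)
  then have M: "finite_borel_on X \<mu>" by (simp add: finite_borel_on_def)
  interpret finite_measure \<mu> using M by (rule finite_borel_onD)
  have sp: "space \<mu> = X" using M by (rule finite_borel_onD)
  have "measure \<mu> X = 1" using eq[OF top] one orbit by simp
  then have "prob_space \<mu>" using sp by (intro prob_spaceI) (simp add: emeasure_eq_measure)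
  then have "\<mu> \<in> prob_measures X" using M by (simp add: prob_measures_def finite_borel_on_def)
  moreover have inv: "distr \<mu> \<mu> (shift h) = \<mu>" for h
  proof (rule shift_invariantI[OF X M])
    fix A assume A: "A \<in> clopens X"
    have "{g. shift g x \<in> shift h -` A \<inter> X} = {g. h + g \<in> {g. shift g x \<in> A}}"
      using orbit by (auto simp: shift_shift)
    then show "measure \<mu> (shift h -` A \<inter> X) = measure \<mu> A"
      using eq[OF shift_vimage_clopens[OF X A]] eq[OF A] minv[of h "{g. shift g x \<in> A}"] by simp
  qed
  moreover have "measure \<mu> A = 0 \<or> measure \<mu> A = 1" if A: "A \<in> sets \<mu>" "\<forall>g. shift g -` A \<inter> X = A" for A
  proof (rule ccontr)
    assume not01: "\<not> ?thesis"
    have "measure \<mu> A \<le> measure \<mu> X" using sets.sets_into_space[OF A(1)] sp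
      by (intro finite_measure_mono) auto
    then have s: "0 < measure \<mu> A" "measure \<mu> A < 1"
      using not01 \<open>measure \<mu> X = 1\<close> measure_nonneg[of \<mu> A] by linarith+
    obtain m\<^sub>1 m\<^sub>2 where m12: "invariant_mean m\<^sub>1" "invariant_mean m\<^sub>2"
      "\<And>D. m D = measure \<mu> A * m\<^sub>1 D + (1 - measure \<mu> A) * m\<^sub>2 D"
      and m1: "\<And>B. B \<in> clopens X \<Longrightarrow> measure \<mu> A * m\<^sub>1 {g. shift g x \<in> B} = measure \<mu> (B \<inter> A)"
      using invariant_mean_split[OF X x m M inv eq A(1) _ s] A(2) by metis
    have indep: "measure \<mu> (B \<inter> A) = measure \<mu> A * measure \<mu> B" if "B \<in> clopens X" for B
      using m1[OF that] extremal[OF m12(1,2) s m12(3) that] eq[OF that] by simp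
    \<comment> \<open>With \<open>B\<close> within \<open>e / 2\<close> of \<open>A\<close>,
      replacing \<open>B\<close> by \<open>A\<close> changes each side of the independence relation
      \<open>indep\<close> by less than \<open>e / 2\<close>.\<close>
    have "\<bar>measure \<mu> A - measure \<mu> A * measure \<mu> A\<bar> \<le> 0 + e" if "e > 0" for e
    proof -
      obtain B where B: "B \<in> clopens X" "measure \<mu> ((A - B) \<union> (B - A)) < e / 2"
        using clopens_approximate[OF M M A(1), of "e / 2"] \<open>e > 0\<close> by auto
      let ?d = "measure \<mu> ((A - B) \<union> (B - A))"
      have BS: "B \<in> sets \<mu>" by (rule clopens_in_sets[OF M B(1)])
      have 1: "measure \<mu> A \<le> measure \<mu> B + ?d" by (rule measure_le_add_symdiff[OF A(1) BS])
      have 2: "measure \<mu> B \<le> measure \<mu> A + ?d"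
        using measure_le_add_symdiff[OF BS A(1)] by (simp add: Un_commute)
      have 3: "measure \<mu> A \<le> measure \<mu> (B \<inter> A) + ?d"
      proof -
        have "measure \<mu> A \<le> measure \<mu> ((B \<inter> A) \<union> ((A - B) \<union> (B - A)))"
          using A(1) BS by (intro finite_measure_mono) auto
        also have "\<dots> \<le> measure \<mu> (B \<inter> A) + ?d" using A(1) BS by (intro measure_Un_le) auto
        finally show ?thesis .
      qed
      have 4: "measure \<mu> (B \<inter> A) \<le> measure \<mu> A" using A(1) by (intro finite_measure_mono) auto
      have "measure \<mu> A * \<bar>measure \<mu> B - measure \<mu> A\<bar> \<le> 1 * ?d"
        using 1 2 s by (intro mult_mono) auto
      then have "\<bar>measure \<mu> A * measure \<mu> B - measure \<mu> A * measure \<mu> A\<bar> \<le> ?d"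
        using s by (simp add: abs_mult right_diff_distrib[symmetric])
      then show ?thesis using indep[OF B(1)] 3 4 B(2) by linarith
    qed
    then have "\<bar>measure \<mu> A - measure \<mu> A * measure \<mu> A\<bar> \<le> 0" by (rule field_le_epsilon)
    then have "measure \<mu> A * (1 - measure \<mu> A) = 0" by (simp add: algebra_simps)
    with s show False by simp
  qed
  ultimately have "\<mu> \<in> erg_measures X"
    by (auto simp: erg_measures_def inv_measures_def)
  then show ?thesis using eq by (rule that)
qed

text \<open>The Hahn decomposition of \<open>q\<close> and \<open>q X * \<mu>\<close> can be chosen invariant, so ergodicity makes one of
  its halves negligible.\<close>

lemma ergodic_dominates_invariant:
  fixes X :: "('g::{group_add, countable} \<Rightarrow> 'a::{finite, discrete_topology}) set"
  assumes X: "subshift X" and \<mu>: "\<mu> \<in> erg_measures X" and q: "fin_additive q"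
    and dom: "\<And>A. A \<in> clopens X \<Longrightarrow> q A \<le> measure \<mu> A"
    and inv: "\<And>g A. A \<in> clopens X \<Longrightarrow> q (shift g -` A \<inter> X) = q A"
    and A: "A \<in> clopens X"
  shows "q A = q X * measure \<mu> A"
proof -
  interpret algebra X "clopens X" by (rule algebra_clopens)
  let ?c = "q X"
  have c: "?c \<ge> 0" by (rule fin_additive_nonneg[OF q])
  have prob: "\<mu> \<in> prob_measures X" and \<mu>_inv: "distr \<mu> \<mu> (shift g) = \<mu>" for g
    using \<mu> by (auto simp: erg_measures_def inv_measures_def)
  have M: "finite_borel_on X \<mu>" by (rule finite_borel_on_prob[OF prob])
  from fin_additive_extends_to_measure[OF _ q, of X] obtain \<nu> where "finite_measure \<nu>" "space \<nu> = X" "sets \<nu> = sets (restrict_space borel X)"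
    and \<nu>: "\<And>A. A \<in> clopens X \<Longrightarrow> measure \<nu> A = q A"
    using X by (auto simp: subshift_def)
  then have N: "finite_borel_on X \<nu>" by (simp add: finite_borel_on_def)
  interpret \<mu>: finite_measure \<mu> using M by (rule finite_borel_onD)
  interpret \<nu>: finite_measure \<nu> using N by (rule finite_borel_onD)
  have sp: "space \<mu> = X" "space \<nu> = X" and ss: "sets \<nu> = sets \<mu>"
    using M N by (auto simp: finite_borel_on_def)
  have \<nu>_inv: "distr \<nu> \<nu> (shift g) = \<nu>" for g
    using \<nu> inv shift_vimage_clopens[OF X] by (intro shift_invariantI[OF X N]) simp
  have \<mu>X: "measure \<mu> X = 1"
    using prob prob_space.prob_space[of \<mu>] sp by (simp add: prob_measures_def)
  have \<nu>X: "measure \<nu> X = ?c" by (rule \<nu>[OF top])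
  have \<nu>_le: "measure \<nu> B \<le> measure \<mu> B" if "B \<in> sets \<mu>" for B
    using measure_mono_from_clopens[OF N M] \<nu> dom that ss by simp
  \<comment> \<open>After scaling, both measures have total mass \<open>?c\<close>, so an inequality
    valid for \<open>A\<close> and for its complement is an equality.\<close>
  let ?c\<mu> = "scale_measure (ennreal ?c) \<mu>"
  have "finite_measure ?c\<mu>"
    by (rule finite_measureI) (simp add: space_scale_measure ennreal_mult_eq_top_iff)
  from finite_unsigned_Hahn_decomposition[OF \<nu>.finite_measure_axioms this] obtain Y where
    Y: "Y \<in> sets \<nu>" "\<And>Z. Z \<in> sets \<nu> \<Longrightarrow> Z \<subseteq> Y \<Longrightarrow> emeasure ?c\<mu> Z \<le> emeasure \<nu> Z"
    "\<And>Z. Z \<in> sets \<nu> \<Longrightarrow> Z \<inter> Y = {} \<Longrightarrow> emeasure \<nu> Z \<le> emeasure ?c\<mu> Z"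
    using ss by auto
  have c\<mu>: "emeasure ?c\<mu> Z = ennreal (?c * measure \<mu> Z)" for Z
    using c by (simp add: \<mu>.emeasure_eq_measure ennreal_mult)
  have pos: "?c * measure \<mu> Z \<le> measure \<nu> Z" if "Z \<in> sets \<mu>" "Z \<subseteq> Y" for Z
    using Y(2)[of Z] that c ss unfolding c\<mu> \<nu>.emeasure_eq_measure by simp
  have neg: "measure \<nu> Z \<le> ?c * measure \<mu> Z" if "Z \<in> sets \<mu>" "Z \<inter> Y = {}" for Z
    using Y(3)[of Z] that c ss unfolding c\<mu> \<nu>.emeasure_eq_measure by simp
  \<comment> \<open>The union of all translates of the positive set \<open>Y\<close> is invariant.
    It is still positive, because a part of it inside a single translate can be shifted into
    \<open>Y\<close>, and both measures are invariant.\<close>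
  define Yg where "Yg g = shift g -` Y \<inter> X" for g
  define Y' where "Y' = (\<Union>g. Yg g)"
  have YgS: "Yg g \<in> sets \<mu>" for g
    unfolding Yg_def using measurable_sets[OF shift_measurable[OF X M], of Y g] Y(1) sp ss by simp
  have Y'S: "Y' \<in> sets \<mu>" unfolding Y'_def by (intro sets.countable_UN') (auto intro: YgS)
  have YX: "Y \<subseteq> X" using sets.sets_into_space[OF Y(1)] sp by simp
  have shX: "shift g x \<in> X" if "x \<in> X" for g x using X that by (simp add: subshift_def)
  have "shift h -` Y' \<inter> X = Y'" for h
  proof -
    have "(\<exists>g. shift (g + h) x \<in> Y) \<longleftrightarrow> (\<exists>g. shift g x \<in> Y)" for x
      by (metis diff_add_cancel)
    then show ?thesis using shX by (auto simp: Y'_def Yg_def shift_shift)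
  qed
  then have "measure \<mu> Y' = 0 \<or> measure \<mu> Y' = 1"
    using \<mu> Y'S by (simp add: erg_measures_def)
  moreover have pos': "?c * measure \<mu> Z \<le> measure \<nu> Z" if Z: "Z \<in> sets \<mu>" "Z \<subseteq> Y'" for Z
  proof -
    \<comment> \<open>Disjoint pieces, each inside a single translate, so that the inequality for
      subsets of \<open>Y\<close> can be summed.\<close>
    define P where "P n = Z \<inter> disjointed (\<lambda>n. Yg (from_nat n)) n" for n
    have PS: "P n \<in> sets \<mu>" for n
      unfolding P_def disjointed_def using Z YgS by (intro sets.Int sets.Diff sets.finite_UN) auto
    have disj: "disjoint_family P"
      using disjoint_family_disjointed[of "\<lambda>n. Yg (from_nat n)"]
      unfolding P_def disjoint_family_on_def by blast
    have "range (\<lambda>n. Yg (from_nat n)) = range Yg"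
      using image_image[of Yg from_nat UNIV] by (simp add: surj_from_nat)
    then have "(\<Union>n. Yg (from_nat n)) = Y'" unfolding Y'_def by simp
    then have UN: "(\<Union>n. P n) = Z"
      unfolding P_def using Z(2) UN_disjointed_eq[of "\<lambda>n. Yg (from_nat n)"] by auto
    have le: "?c * measure \<mu> (P n) \<le> measure \<nu> (P n)" for n
    proof -
      define g :: 'g where "g = from_nat n"
      let ?W = "shift (- g) -` P n \<inter> X"
      have WS: "?W \<in> sets \<mu>"
        using measurable_sets[OF shift_measurable[OF X M] PS] sp by simp
      have "P n \<subseteq> Yg g"
        using disjointed_subset[of "\<lambda>n. Yg (from_nat n)" n] by (auto simp: P_def g_def)
      then have "?W \<subseteq> Y" by (auto simp: Yg_def shift_shift shift_0)
      from pos[OF WS this] show ?thesis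
        using measure_shift_vimage[OF X M \<mu>_inv PS] measure_shift_vimage[OF X N \<nu>_inv] PS ss by simp
    qed
    have "(\<lambda>n. ?c * measure \<mu> (P n)) sums (?c * measure \<mu> Z)"
      using \<mu>.finite_measure_UNION[OF _ disj] PS UN by (intro sums_mult) auto
    moreover have "(\<lambda>n. measure \<nu> (P n)) sums measure \<nu> Z"
      using \<nu>.finite_measure_UNION[OF _ disj] PS UN ss by auto
    ultimately show ?thesis using le by (rule sums_le[rotated])
  qed
  have AS: "A \<in> sets \<mu>" by (rule clopens_in_sets[OF M A])
  have XS: "X \<in> sets \<mu>" by (rule clopens_in_sets[OF M top])
  have compl: "measure \<mu> (X - A) = 1 - measure \<mu> A" "measure \<nu> (X - A) = ?c - measure \<nu> A"
    using \<mu>.finite_measure_compl[of A] \<nu>.finite_measure_compl[of A] AS sp ss \<mu>X \<nu>X by auto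
  have "measure \<nu> A = ?c * measure \<mu> A"
    using calculation
  proof
    assume 0: "measure \<mu> Y' = 0"
    \<comment> \<open>Here the domination of \<open>q\<close> by \<open>\<mu>\<close> enters: a
      \<open>\<mu>\<close>-null set is \<open>\<nu>\<close>-null.\<close>
    have "measure \<nu> Y' = 0" using \<nu>_le[OF Y'S] 0 by (simp add: measure_le_0_iff)
    have "Y \<subseteq> Y'" unfolding Y'_def Yg_def using YX by (auto intro!: exI[of _ 0] simp: shift_0)
    have le: "measure \<nu> B \<le> ?c * measure \<mu> B" if B: "B \<in> sets \<mu>" for B
    proof -
      have "measure \<nu> B \<le> measure \<nu> ((B - Y') \<union> Y')"
        using B Y'S ss by (intro \<nu>.finite_measure_mono) auto
      also have "\<dots> \<le> measure \<nu> (B - Y') + measure \<nu> Y'"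
        using B Y'S ss by (intro measure_Un_le) auto
      also have "measure \<nu> (B - Y') \<le> ?c * measure \<mu> (B - Y')"
        using \<open>Y \<subseteq> Y'\<close> B Y'S by (intro neg) auto
      also have "\<dots> \<le> ?c * measure \<mu> B"
        using c B by (intro mult_left_mono \<mu>.finite_measure_mono) auto
      finally show ?thesis using \<open>measure \<nu> Y' = 0\<close> by simp
    qed
    have "X - A \<in> sets \<mu>" using AS XS by auto
    from le[OF AS] le[OF this] show ?thesis by (simp add: compl algebra_simps)
  next
    assume 1: "measure \<mu> Y' = 1"
    have le: "?c * measure \<mu> B \<le> measure \<nu> B" if B: "B \<in> sets \<mu>" for B
    proof -
      have BX: "B \<subseteq> X" using sets.sets_into_space[OF B] sp by simp
      have "measure \<mu> B \<le> measure \<mu> ((B \<inter> Y') \<union> (X - Y'))"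
        using B Y'S XS BX by (intro \<mu>.finite_measure_mono) auto
      also have "\<dots> \<le> measure \<mu> (B \<inter> Y') + measure \<mu> (X - Y')"
        using B Y'S XS by (intro measure_Un_le) auto
      also have "measure \<mu> (X - Y') = 0"
        using \<mu>.finite_measure_compl[OF Y'S] sp \<mu>X 1 by simp
      finally have "?c * measure \<mu> B \<le> ?c * measure \<mu> (B \<inter> Y')"
        using c by (simp add: mult_left_mono)
      also have "\<dots> \<le> measure \<nu> (B \<inter> Y')" using B Y'S by (intro pos') auto
      also have "\<dots> \<le> measure \<nu> B" using B ss by (intro \<nu>.finite_measure_mono) auto
      finally show ?thesis .
    qed
    have "X - A \<in> sets \<mu>" using AS XS by auto
    from le[OF AS] le[OF this] show ?thesis by (simp add: compl algebra_simps)
  qed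
  then show ?thesis using \<nu>[OF A] by simp
qed

section \<open>Tilings\<close>

lemma plus_singleton_eq: "(A :: 'g::group_add set) + {c} = (\<lambda>a. a + c) ` A"
  by (auto simp: set_plus_def)

lemma tile_cases:
  assumes "tiling S t" "A \<in> tiles S t"
  obtains c i where "t c = Some i" "i < length S" "A = tile S t c" "A = S ! i + {c}"
proof -
  obtain c i where c: "t c = Some i" "A = tile S t c" using assms(2) by (auto simp: tiles_def)
  then have "Some i \<in> symbols S" using assms(1) by (metis range_subsetD tiling_def)
  then have "i < length S" by (auto simp: symbols_def)
  then show ?thesis using c by (intro that[of c i]) (auto simp: tile_def)
qed

lemma sum_Sigma_Sigma:
  assumes "finite I" "\<And>i. i \<in> I \<Longrightarrow> finite (B i)" "\<And>i j. i \<in> I \<Longrightarrow> j \<in> B i \<Longrightarrow> finite (Z i j)"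
  shows "(\<Sum>p\<in>(SIGMA i:I. SIGMA j:B i. Z i j). f p) = (\<Sum>i\<in>I. \<Sum>j\<in>B i. \<Sum>k\<in>Z i j. f (i, j, k))"
proof -
  have "(\<Sum>j\<in>B i. \<Sum>k\<in>Z i j. f (i, j, k)) = (\<Sum>p\<in>(SIGMA j:B i. Z i j). f (i, p))" if "i \<in> I" for i
    using assms(2,3) that by (subst sum.Sigma) (auto simp: case_prod_unfold)
  then have "(\<Sum>i\<in>I. \<Sum>j\<in>B i. \<Sum>k\<in>Z i j. f (i, j, k)) = (\<Sum>i\<in>I. \<Sum>p\<in>(SIGMA j:B i. Z i j). f (i, p))"
    by (intro sum.cong) auto
  also have "\<dots> = (\<Sum>p\<in>(SIGMA i:I. SIGMA j:B i. Z i j). f p)"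
    using assms by (subst sum.Sigma) (auto simp: case_prod_unfold)
  finally show ?thesis ..
qed

text \<open>A tile is determined, up to translation, by its shape \<open>S ! i\<close> and the trace \<open>R\<close> of \<open>E\<close> on it. There are
  finitely many such types, and \<open>m\<close> gives the same mass to all the translates of the set of centers of a
  given type.\<close>

lemma mean_tiles_lower_bound:
  fixes m :: "'g::group_add set \<Rightarrow> real"
  assumes S: "shape_collection S" and t: "tiling S t" and m: "invariant_mean m"
    and Q: "\<Q> \<subseteq> tiles S t" and dense: "\<And>A. A \<in> \<Q> \<Longrightarrow> \<theta> * real (card A) \<le> real (card (E \<inter> A))"
  shows "\<theta> * m (\<Union>\<Q>) \<le> m (E \<inter> \<Union>\<Q>)"
proof -
  have add: "fin_additive m" and minv: "\<And>h D. m {g. h + g \<in> D} = m D"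
    using m by (auto simp: invariant_mean_def)
  have finS: "finite (S ! i)" if "i < length S" for i
    using S that by (auto simp: shape_collection_def)
  define c where "c i R = {c. t c = Some i \<and> tile S t c \<in> \<Q> \<and> {s \<in> S ! i. s + c \<in> E} = R}" for i R
  \<comment> \<open>\<open>T (i, R, s)\<close> collects the points in position \<open>s\<close> of
    the tiles of type \<open>(i, R)\<close>. It is a left translate of the set of their centers, so
    its mass does not depend on \<open>s\<close>. Restricting \<open>s\<close> to \<open>R\<close>,
    as in \<open>J'\<close>, selects the points of \<open>E\<close>.\<close>
  define T where "T = (\<lambda>(i, R, s). {g. - s + g \<in> c i R})"
  define J where "J = (SIGMA i:{..<length S}. SIGMA R:Pow (S ! i). S ! i)"
  define J' where "J' = (SIGMA i:{..<length S}. SIGMA R:Pow (S ! i). R)"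
  have finJ: "finite J" "finite J'"
    unfolding J_def J'_def using finS by (auto intro!: finite_SigmaI intro: finite_subset)
  have in_tile: "g \<in> tile S t (- s + g)" if "t (- s + g) = Some i" "s \<in> S ! i" for g s i
    using that by (auto simp: tile_def plus_singleton_eq intro!: image_eqI[of _ _ s])
  have disj: "disjoint_family_on T J"
    unfolding disjoint_family_on_def
  proof (intro ballI impI)
    fix p p' assume p: "p \<in> J" "p' \<in> J" "p \<noteq> p'"
    obtain i R s i' R' s' where pp: "p = (i, R, s)" "p' = (i', R', s')" by (metis prod_cases3)
    show "T p \<inter> T p' = {}"
    proof (rule ccontr)
      assume "T p \<inter> T p' \<noteq> {}"
      then obtain g where g: "- s + g \<in> c i R" "- s' + g \<in> c i' R'" by (auto simp: T_def pp)
      then have ti: "t (- s + g) = Some i" "t (- s' + g) = Some i'" by (auto simp: c_def)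
      have "s \<in> S ! i" "s' \<in> S ! i'" using p by (auto simp: pp J_def)
      then have "g \<in> tile S t (- s + g) \<inter> tile S t (- s' + g)" using ti in_tile by blast
      moreover have "tile S t (- s + g) \<in> tiles S t" "tile S t (- s' + g) \<in> tiles S t"
        using ti by (auto simp: tiles_def)
      ultimately have "tile S t (- s + g) = tile S t (- s' + g)"
        using t unfolding tiling_def partition_on_def disjoint_def by blast
      then have eq: "- s + g = - s' + g"
        using t ti unfolding tiling_def inj_on_def by (metis domI)
      then have "s = s'" "i = i'" using ti by auto
      moreover from this have "R = R'" using g by (auto simp: c_def)
      ultimately show False using p(3) pp by simp
    qed
  qed
  have J'J: "J' \<subseteq> J" by (auto simp: J_def J'_def)
  have UN: "(\<Union>p\<in>J. T p) = \<Union>\<Q>" "(\<Union>p\<in>J'. T p) = E \<inter> \<Union>\<Q>"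
  proof -
    have type: "\<exists>i<length S. \<exists>R\<in>Pow (S ! i). \<exists>s\<in>S ! i. g \<in> T (i, R, s) \<and> (g \<in> E \<longrightarrow> s \<in> R)"
      if gA: "g \<in> A" "A \<in> \<Q>" for g A
    proof -
      obtain d i where d: "t d = Some i" "i < length S" "A = tile S t d" "A = S ! i + {d}"
        using tile_cases[OF t] gA(2) Q by (metis subsetD)
      obtain s where s: "s \<in> S ! i" "g = s + d" using gA(1) d(4) by (auto simp: plus_singleton_eq)
      let ?R = "{s \<in> S ! i. s + d \<in> E}"
      have "g \<in> T (i, ?R, s)" using d gA(2) s by (simp add: T_def c_def add.assoc[symmetric])
      then show ?thesis using d(2) s by (intro exI[of _ i] conjI bexI[of _ ?R] bexI[of _ s]) auto
    qed
    have sub: "T (i, R, s) \<subseteq> \<Union>\<Q> \<and> (s \<in> R \<longrightarrow> T (i, R, s) \<subseteq> E) \<and> (s \<notin> R \<longrightarrow> T (i, R, s) \<inter> E = {})"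
      if "s \<in> S ! i" for i R s
    proof -
      have "g \<in> \<Union>\<Q> \<and> (s \<in> R \<longleftrightarrow> g \<in> E)" if "g \<in> T (i, R, s)" for g
      proof -
        from that have g: "t (- s + g) = Some i" "tile S t (- s + g) \<in> \<Q>"
          "R = {s' \<in> S ! i. s' + (- s + g) \<in> E}" by (auto simp: T_def c_def)
        have "g \<in> tile S t (- s + g)" by (rule in_tile[OF g(1) \<open>s \<in> S ! i\<close>])
        then show ?thesis using g \<open>s \<in> S ! i\<close> by (auto simp: add.assoc[symmetric])
      qed
      then show ?thesis by blast
    qed
    show "(\<Union>p\<in>J. T p) = \<Union>\<Q>"
    proof
      show "(\<Union>p\<in>J. T p) \<subseteq> \<Union>\<Q>"
      proof (rule UN_least)
        fix p assume "p \<in> J"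
        then obtain i R s where "p = (i, R, s)" "s \<in> S ! i" by (auto simp: J_def)
        then show "T p \<subseteq> \<Union>\<Q>" using sub by simp
      qed
      show "\<Union>\<Q> \<subseteq> (\<Union>p\<in>J. T p)"
      proof
        fix g assume "g \<in> \<Union>\<Q>"
        then obtain i R s where "i < length S" "R \<in> Pow (S ! i)" "s \<in> S ! i" "g \<in> T (i, R, s)"
          using type by blast
        then show "g \<in> (\<Union>p\<in>J. T p)" unfolding J_def by (intro UN_I[of "(i, R, s)"]) auto
      qed
    qed
    show "(\<Union>p\<in>J'. T p) = E \<inter> \<Union>\<Q>"
    proof
      show "(\<Union>p\<in>J'. T p) \<subseteq> E \<inter> \<Union>\<Q>"
      proof
        fix g assume "g \<in> (\<Union>p\<in>J'. T p)"
        then obtain i R s where "R \<subseteq> S ! i" "s \<in> R" "g \<in> T (i, R, s)" by (auto simp: J'_def)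
        then show "g \<in> E \<inter> \<Union>\<Q>" using sub[of s i R] by blast
      qed
      show "E \<inter> \<Union>\<Q> \<subseteq> (\<Union>p\<in>J'. T p)"
      proof
        fix g assume "g \<in> E \<inter> \<Union>\<Q>"
        then obtain i R s where "i < length S" "R \<in> Pow (S ! i)" "s \<in> R" "g \<in> T (i, R, s)"
          using type by blast
        then show "g \<in> (\<Union>p\<in>J'. T p)" unfolding J'_def by (intro UN_I[of "(i, R, s)"]) auto
      qed
    qed
  qed
  have mT: "m (T (i, R, s)) = m (c i R)" for i R s
    using minv[of "- s" "c i R"] by (simp add: T_def)
  have mJ: "m (\<Union>\<Q>) = (\<Sum>i<length S. \<Sum>R\<in>Pow (S ! i). real (card (S ! i)) * m (c i R))"
  proof -
    have "m (\<Union>\<Q>) = (\<Sum>p\<in>J. m (T p))"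
      unfolding UN(1)[symmetric] by (rule fin_additive_UN[OF add finJ(1) disj])
    also have "\<dots> = (\<Sum>i<length S. \<Sum>R\<in>Pow (S ! i). \<Sum>s\<in>S ! i. m (T (i, R, s)))"
      unfolding J_def using finS by (intro sum_Sigma_Sigma) auto
    finally show ?thesis by (simp add: mT)
  qed
  have mJ': "m (E \<inter> \<Union>\<Q>) = (\<Sum>i<length S. \<Sum>R\<in>Pow (S ! i). real (card R) * m (c i R))"
  proof -
    have fin: "finite R" if "i < length S" "R \<subseteq> S ! i" for i R using finS that finite_subset by blast
    have "m (E \<inter> \<Union>\<Q>) = (\<Sum>p\<in>J'. m (T p))"
      unfolding UN(2)[symmetric]
      by (rule fin_additive_UN[OF add finJ(2) disjoint_family_on_mono[OF J'J disj]])
    also have "\<dots> = (\<Sum>i<length S. \<Sum>R\<in>Pow (S ! i). \<Sum>s\<in>R. m (T (i, R, s)))"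
      unfolding J'_def using finS fin by (intro sum_Sigma_Sigma) auto
    finally show ?thesis by (simp add: mT)
  qed
  \<comment> \<open>An empty type has mass 0; a nonempty one is realized by a tile in
    \<open>\<Q>\<close>, to which the density hypothesis applies.\<close>
  have "\<theta> * (real (card (S ! i)) * m (c i R)) \<le> real (card R) * m (c i R)" if i: "i < length S" for i R
  proof (cases "c i R = {}")
    case True
    then show ?thesis using fin_additive_empty[OF add] by simp
  next
    case False
    then obtain d where d: "t d = Some i" "tile S t d \<in> \<Q>" "R = {s \<in> S ! i. s + d \<in> E}"
      by (auto simp: c_def)
    have inj: "inj_on (\<lambda>a. a + d) Z" for Z by (auto simp: inj_on_def)
    have A: "tile S t d = (\<lambda>a. a + d) ` (S ! i)" using d(1) by (simp add: tile_def plus_singleton_eq)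
    have "E \<inter> tile S t d = (\<lambda>a. a + d) ` R" unfolding A d(3) by auto
    then have "card (E \<inter> tile S t d) = card R" "card (tile S t d) = card (S ! i)"
      unfolding A by (simp_all add: card_image[OF inj])
    then have "\<theta> * real (card (S ! i)) \<le> real (card R)" using dense[OF d(2)] by simp
    then show ?thesis using fin_additive_nonneg[OF add, of "c i R"]
      by (simp add: mult.assoc[symmetric] mult_right_mono)
  qed
  then show ?thesis unfolding mJ mJ' sum_distrib_left by (intro sum_mono) auto
qed

section \<open>Almost invariance of tiles and of unions of tiles\<close>

text \<open>Left multiplication commutes with right translation, so a tile inherits the invariance
  of its shape.\<close>

lemma inv_under_translate:
  assumes "inv_under K \<delta> F"
  shows "inv_under K \<delta> (F + {c})"
proof -
  have inj: "inj (\<lambda>a. a + c)" by (auto simp: inj_on_def)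
  have "K + (F + {c}) = (K + F) + {c}" by (simp add: add.assoc)
  then have "((F + {c}) - (K + (F + {c}))) \<union> ((K + (F + {c})) - (F + {c}))
      = (\<lambda>a. a + c) ` ((F - (K + F)) \<union> ((K + F) - F))"
    unfolding plus_singleton_eq by (simp only: image_Un image_set_diff[OF inj])
  moreover have "card (F + {c}) = card F" "card ((\<lambda>a. a + c) ` Z) = card Z" for Z
    unfolding plus_singleton_eq by (simp_all add: card_image inj_on_subset[OF inj])
  ultimately show ?thesis using assms by (simp add: inv_under_def plus_singleton_eq)
qed

lemma inv_under_card_le:
  assumes "inv_under K \<delta> A" "finite K" "h \<in> K"
  shows "real (card {g \<in> A. h + g \<notin> A}) \<le> \<delta> * real (card A)"
proof -
  have A: "finite A" "A \<noteq> {}" using assms(1) by (auto simp: inv_under_def)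
  let ?D = "(A - (K + A)) \<union> ((K + A) - A)"
  have "K + A = (\<lambda>(k, a). k + a) ` (K \<times> A)" by (auto simp: set_plus_def)
  then have "finite (K + A)" using assms(2) A by simp
  then have finD: "finite ?D" using A by simp
  have "card {g \<in> A. h + g \<notin> A} = card ((\<lambda>g. h + g) ` {g \<in> A. h + g \<notin> A})"
    by (intro card_image[symmetric]) (auto simp: inj_on_def)
  also have "\<dots> \<le> card ?D"
    using finD assms(3) by (intro card_mono) (auto intro: set_plus_intro)
  finally have "real (card {g \<in> A. h + g \<notin> A}) \<le> real (card ?D)" by simp
  moreover have "real (card ?D) \<le> \<delta> * real (card A)"
    using assms(1) A by (simp add: inv_under_def divide_less_eq card_gt_0_iff less_imp_le)
  ultimately show ?thesis by simp
qed

text \<open>Translation by \<open>h\<close> keeps all but a fraction \<delta> of each tile inside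
  that same tile, whatever the other members of the family are. Hence any subfamily, even one
  selected by looking at a configuration, has an almost invariant union. The two differences have
  equal mass because \<open>m\<close> is invariant, whence the factor 2.\<close>

lemma mean_tiles_symdiff_le:
  fixes m :: "'g::group_add set \<Rightarrow> real"
  assumes S: "shape_collection S" and t: "tiling S t" and m: "invariant_mean m"
    and Q: "\<Q> \<subseteq> tiles S t" and inv: "\<And>A. A \<in> \<Q> \<Longrightarrow> inv_under {h} \<delta> A" and \<delta>: "\<delta> \<ge> 0"
  shows "m (({g. h + g \<in> \<Union>\<Q>} - \<Union>\<Q>) \<union> (\<Union>\<Q> - {g. h + g \<in> \<Union>\<Q>})) \<le> 2 * \<delta>"
proof -
  have add: "fin_additive m" and minv: "\<And>D. m {g. h + g \<in> D} = m D"
    using m by (auto simp: invariant_mean_def)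
  let ?M = "\<Union>\<Q>" and ?E = "{g. h + g \<in> \<Union>\<Q>}"
  have "(1 - \<delta>) * m ?M \<le> m (?E \<inter> ?M)"
  proof (rule mean_tiles_lower_bound[OF S t m Q])
    fix A assume A: "A \<in> \<Q>"
    have fin: "finite A" using inv[OF A] by (simp add: inv_under_def)
    have "card A = card {g \<in> A. h + g \<notin> A} + card {g \<in> A. h + g \<in> A}"
      using fin by (subst card_Un_disjoint[symmetric]) (auto intro!: arg_cong[where f = card])
    moreover have "card {g \<in> A. h + g \<in> A} \<le> card (?E \<inter> A)"
      using fin A by (intro card_mono) auto
    ultimately show "(1 - \<delta>) * real (card A) \<le> real (card (?E \<inter> A))"
      using inv_under_card_le[OF inv[OF A]] by (simp add: left_diff_distrib)
  qed
  moreover have "\<delta> * m ?M \<le> \<delta>"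
    using \<delta> invariant_mean_le_1[OF m, of ?M] by (simp add: mult_left_le)
  moreover have "m ((?E - ?M) \<union> (?M - ?E)) = m (?E - ?M) + m (?M - ?E)"
    by (rule fin_additive_Un[OF add]) auto
  ultimately show ?thesis
    using fin_additive_Diff[OF add, of ?E ?M] fin_additive_Diff[OF add, of ?M ?E] minv[of ?M]
    by (simp add: Int_commute algebra_simps)
qed

section \<open>The pseudometric\<close>

lemma finite_blocks_on: "finite K \<Longrightarrow> finite (blocks_on K :: ('g, 'a::finite) block set)"
  using finite_set_of_finite_maps[of K "UNIV :: 'a set"] by (simp add: blocks_on_def)

lemma dom_restr [simp]: "dom (restr x F) = F"
  by (auto simp: restr_def)

lemma sum_cylinders:
  fixes X :: "('g::countable \<Rightarrow> 'a::{finite, discrete_topology}) set"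
  assumes \<mu>: "\<mu> \<in> prob_measures X" and K: "finite K"
  shows "(\<Sum>C\<in>blocks_on K. measure \<mu> (cylinder X C)) = 1"
proof -
  interpret prob_space \<mu> using \<mu> by (simp add: prob_measures_def)
  have "cylinder X ` blocks_on K \<subseteq> sets \<mu>"
    using K cylinder_clopen[of _ X] clopens_in_sets[OF finite_borel_on_prob[OF \<mu>]]
    by (auto simp: blocks_on_def)
  moreover have "disjoint_family_on (cylinder X) (blocks_on K)"
    by (auto simp: disjoint_family_on_def cylinder_def blocks_on_def)
  ultimately have "(\<Sum>C\<in>blocks_on K. measure \<mu> (cylinder X C)) = measure \<mu> (\<Union>C\<in>blocks_on K. cylinder X C)"
    using finite_blocks_on[OF K] by (intro finite_measure_finite_Union[symmetric])
  also have "(\<Union>C\<in>blocks_on K. cylinder X C) = space \<mu>"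
  proof -
    have "x \<in> cylinder X (restr x K)" "restr x K \<in> blocks_on K" if "x \<in> X" for x
      using that by (auto simp: cylinder_def blocks_on_def)
    then have "X \<subseteq> (\<Union>C\<in>blocks_on K. cylinder X C)" by blast
    moreover have "(\<Union>C\<in>blocks_on K. cylinder X C) \<subseteq> X" by (auto simp: cylinder_def)
    ultimately have "(\<Union>C\<in>blocks_on K. cylinder X C) = X" by (rule order.antisym[rotated])
    then show ?thesis using \<mu> by (simp add: prob_measures_def)
  qed
  finally show ?thesis by (simp add: prob_space)
qed

text \<open>Every point of the core sees exactly one block over \<open>K\<close>, so the total falls
  short of 1 only by the boundary of the domain.\<close>

lemma sum_Fr:
  fixes B :: "('g::group_add, 'a::finite) block"
  assumes K: "finite K" and B: "finite (dom B)"
  shows "(\<Sum>C\<in>blocks_on K. Fr B C) = real (card (core K (dom B))) / real (card (dom B))"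
proof -
  let ?G = "\<lambda>C. {g \<in> core K (dom B). matches C B g}"
  have fin: "finite (core K (dom B))" using B by (simp add: core_def)
  have "core K (dom B) \<subseteq> (\<Union>C\<in>blocks_on K. ?G C)"
  proof
    fix g assume g: "g \<in> core K (dom B)"
    then have "B (k + g) \<noteq> None" if "k \<in> K" for k
      using that by (auto simp: core_def plus_singleton_eq)
    then have "(\<lambda>k. if k \<in> K then B (k + g) else None) \<in> blocks_on K"
      by (auto simp: blocks_on_def dom_def split: if_splits)
    moreover have "matches (\<lambda>k. if k \<in> K then B (k + g) else None) B g"
      by (auto simp: matches_def split: if_splits)
    ultimately show "g \<in> (\<Union>C\<in>blocks_on K. ?G C)" using g by blast
  qed
  then have "core K (dom B) = (\<Union>C\<in>blocks_on K. ?G C)" by auto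
  moreover have "?G C \<inter> ?G D = {}" if "C \<in> blocks_on K" "D \<in> blocks_on K" "C \<noteq> D" for C D
  proof -
    have "C = D" if "matches C B g" "matches D B g" for g
    proof
      fix k
      show "C k = D k"
        using that \<open>C \<in> blocks_on K\<close> \<open>D \<in> blocks_on K\<close>
        by (cases "k \<in> K") (auto simp: matches_def blocks_on_def domIff)
    qed
    then show ?thesis using \<open>C \<noteq> D\<close> by auto
  qed
  ultimately have "card (core K (dom B)) = (\<Sum>C\<in>blocks_on K. card (?G C))"
    using finite_blocks_on[OF K] fin by (subst card_UN_disjoint[symmetric]) auto
  moreover have "Fr B C = real (card (?G C)) / real (card (dom B))" if "C \<in> blocks_on K" for C
    using that by (simp add: Fr_def blocks_on_def)
  ultimately show ?thesis by (simp add: sum_divide_distrib)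
qed

text \<open>A point of \<open>A\<close> is outside the core only if some element of \<open>K\<close>
  moves it out of \<open>A\<close>. The union bound costs a factor \<open>card K\<close>, which the
  denominators in \<open>dstar\<close> absorb.\<close>

lemma card_core_ge:
  fixes A :: "'g::group_add set"
  assumes inv: "inv_under K' \<delta> A" and K': "finite K'" "K \<subseteq> K'"
  shows "(1 - real (card K) * \<delta>) * real (card A) \<le> real (card (core K A))"
proof -
  have A: "finite A" using inv by (simp add: inv_under_def)
  have "core K A \<subseteq> A" by (auto simp: core_def)
  have finK: "finite K" using K' by (rule finite_subset[rotated])
  have "A - core K A \<subseteq> (\<Union>h\<in>K. {g \<in> A. h + g \<notin> A})"
    by (auto simp: core_def plus_singleton_eq)
  then have "card (A - core K A) \<le> card (\<Union>h\<in>K. {g \<in> A. h + g \<notin> A})"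
    using A finK by (intro card_mono) auto
  also have "\<dots> \<le> (\<Sum>h\<in>K. card {g \<in> A. h + g \<notin> A})"
    by (rule card_UN_le[OF finK])
  finally have "real (card (A - core K A)) \<le> (\<Sum>h\<in>K. real (card {g \<in> A. h + g \<notin> A}))"
    by (simp only: of_nat_sum[symmetric] of_nat_le_iff)
  also have "\<dots> \<le> (\<Sum>h\<in>K. \<delta> * real (card A))"
    using K' by (intro sum_mono inv_under_card_le[OF inv]) auto
  finally have "real (card (A - core K A)) \<le> real (card K) * \<delta> * real (card A)" by simp
  moreover have "card A = card (A - core K A) + card (core K A)"
    using A \<open>core K A \<subseteq> A\<close> card_mono[OF A \<open>core K A \<subseteq> A\<close>]
    by (simp add: card_Diff_subset finite_subset)
  ultimately show ?thesis by (simp add: algebra_simps)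
qed

text \<open>As both distributions have total mass (almost) \<open>1\<close>, an upper bound for \<open>b - a\<close> controls the
  \<open>\<ell>\<^sup>1\<close>-distance.\<close>

lemma sum_abs_diff_le:
  fixes a b :: "'b \<Rightarrow> real"
  assumes "\<And>i. i \<in> I \<Longrightarrow> b i \<le> a i + \<eta>" "\<eta> \<ge> 0"
  shows "(\<Sum>i\<in>I. \<bar>a i - b i\<bar>) \<le> (\<Sum>i\<in>I. a i) - (\<Sum>i\<in>I. b i) + 2 * \<eta> * real (card I)"
proof -
  have "(\<Sum>i\<in>I. \<bar>a i - b i\<bar>) \<le> (\<Sum>i\<in>I. (a i - b i) + 2 * \<eta>)"
  proof (rule sum_mono)
    show "\<bar>a i - b i\<bar> \<le> (a i - b i) + 2 * \<eta>" if "i \<in> I" for i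
      using assms(1)[OF that] assms(2) by linarith
  qed
  then show ?thesis by (simp add: sum.distrib sum_subtractf mult.commute)
qed

text \<open>Used in contraposition: a sufficiently invariant block far from \<mu> has an excess of
  one of finitely many blocks.\<close>

lemma dstar_small:
  fixes X :: "('g::{group_add, countable} \<Rightarrow> 'a::{finite, discrete_topology}) set"
  assumes \<mu>: "\<mu> \<in> prob_measures X" and K: "\<And>l. finite (K l)" and r: "r > 0"
  obtains I \<eta> K' \<delta> where "finite I" "\<And>C. C \<in> I \<Longrightarrow> finite (dom C)" "\<eta> > 0"
    "finite K'" "K' \<noteq> {}" "\<delta> > 0"
    "\<And>B. inv_under K' \<delta> (dom B) \<Longrightarrow> (\<And>C. C \<in> I \<Longrightarrow> Fr B C < measure \<mu> (cylinder X C) + \<eta>) \<Longrightarrow>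
      dstar K X (Inr \<mu>) (Inl B) < r"
proof -
  \<comment> \<open>Each summand is at most \<open>(1 / 2) ^ l\<close>, so the tail from
    \<open>L\<close> on is at most \<open>2 * (1 / 2) ^ L\<close>, which is less than
    \<open>r / 2\<close>. The head will be at most \<open>r / 4\<close>.\<close>
  obtain L where L: "(1 / 2 :: real) ^ L < r / 4"
    using real_arch_pow_inv[of "r / 4" "1 / 2"] r by auto
  define I :: "('g, 'a) block set" where "I = (\<Union>l<L. blocks_on (K l))"
  \<comment> \<open>The unit makes this set nonempty, as test sets in \<open>folner_seq\<close> must
    be.\<close>
  define K' where "K' = insert 0 (\<Union>l<L. K l)"
  \<comment> \<open>Chosen so that \<open>2 * \<eta> * card I \<le> r / 4\<close>; the added 1
    excludes division by zero.\<close>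
  define \<eta> where "\<eta> = r / (8 * (1 + real (card I)))"
  have finI: "finite I" using K finite_blocks_on by (auto simp: I_def)
  have \<eta>: "\<eta> > 0" using r by (simp add: \<eta>_def add_pos_nonneg)
  have \<eta>I: "2 * \<eta> * real (card I) \<le> r / 4"
    using r by (simp add: \<eta>_def field_simps)
  show ?thesis
  proof (rule that[of I \<eta> K' "r / 4"])
    show "finite I" "\<eta> > 0" "r / 4 > 0" using finI \<eta> r by auto
    show "finite K'" "K' \<noteq> {}" using K by (auto simp: K'_def)
    show "finite (dom C)" if "C \<in> I" for C using that K by (auto simp: I_def blocks_on_def)
    fix B :: "('g, 'a) block"
    assume inv: "inv_under K' (r / 4) (dom B)"
      and Fr: "\<And>C. C \<in> I \<Longrightarrow> Fr B C < measure \<mu> (cylinder X C) + \<eta>"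
    have B: "finite (dom B)" "card (dom B) > 0" using inv by (auto simp: inv_under_def card_gt_0_iff)
    define s where "s l = (\<Sum>C\<in>blocks_on (K l). \<bar>weight X (Inr \<mu>) C - weight X (Inl B) C\<bar>)" for l
    define u where "u l = (1 / 2) ^ Suc l / (real (card (K l)) + 1) * s l" for l
    have s_nonneg: "0 \<le> s l" for l by (simp add: s_def sum_nonneg)
    have s_le_2: "s l \<le> 2" for l
    proof -
      have "s l \<le> (\<Sum>C\<in>blocks_on (K l). measure \<mu> (cylinder X C) + Fr B C)"
        unfolding s_def by (intro sum_mono) (auto simp: Fr_def abs_le_iff add_increasing2 intro: order.trans[OF _ add_nonneg_nonneg])
      also have "\<dots> = 1 + real (card (core (K l) (dom B))) / real (card (dom B))"
        by (simp add: sum.distrib sum_cylinders[OF \<mu> K] sum_Fr[OF K B(1)])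
      also have "\<dots> \<le> 2"
        using B card_mono[of "dom B" "core (K l) (dom B)"] by (auto simp: core_def)
      finally show ?thesis .
    qed
    \<comment> \<open>The boundary contributes \<open>card (K l) * (r / 4)\<close> and the allowed
      excess \<open>r / 4\<close>; the denominator in \<open>dstar\<close> cancels the factor
      \<open>card (K l) + 1\<close> of their sum.\<close>
    have s_small: "s l \<le> (real (card (K l)) + 1) * (r / 4)" if "l < L" for l
    proof -
      have sub: "blocks_on (K l) \<subseteq> I" using that by (auto simp: I_def)
      have "s l \<le> (\<Sum>C\<in>blocks_on (K l). measure \<mu> (cylinder X C)) - (\<Sum>C\<in>blocks_on (K l). Fr B C)
          + 2 * \<eta> * real (card (blocks_on (K l) :: ('g, 'a) block set))"
        unfolding s_def weight.simps using Fr sub \<eta> by (intro sum_abs_diff_le) (auto intro: less_imp_le)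
      also have "\<dots> \<le> real (card (K l)) * (r / 4) + 2 * \<eta> * real (card I)"
      proof -
        have "K l \<subseteq> K'" using that by (auto simp: K'_def)
        from card_core_ge[OF inv \<open>finite K'\<close> this]
        have "1 - real (card (K l)) * (r / 4) \<le> real (card (core (K l) (dom B))) / real (card (dom B))"
          using B by (simp add: pos_le_divide_eq)
        moreover have "2 * \<eta> * real (card (blocks_on (K l) :: ('g, 'a) block set)) \<le> 2 * \<eta> * real (card I)"
          using \<eta> sub finI by (intro mult_left_mono) (auto intro: card_mono)
        ultimately show ?thesis by (simp add: sum_cylinders[OF \<mu> K] sum_Fr[OF K B(1)])
      qed
      also have "\<dots> \<le> (real (card (K l)) + 1) * (r / 4)" using \<eta>I by (simp add: algebra_simps)
      finally show ?thesis .
    qed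
    have u_nonneg: "0 \<le> u l" for l using s_nonneg by (simp add: u_def)
    have u_le: "u l \<le> (1 / 2) ^ l" for l
    proof -
      have "u l \<le> (1 / 2) ^ Suc l / 1 * 2"
        unfolding u_def using s_nonneg s_le_2 by (intro mult_mono divide_left_mono) auto
      then show ?thesis by simp
    qed
    have u_small: "u l \<le> (1 / 2) ^ Suc l * (r / 4)" if "l < L" for l
    proof -
      have "u l \<le> (1 / 2) ^ Suc l / (real (card (K l)) + 1) * ((real (card (K l)) + 1) * (r / 4))"
        unfolding u_def using s_small[OF that] by (intro mult_left_mono) auto
      also have "\<dots> = (1 / 2) ^ Suc l * (r / 4)"
      proof -
        have "a / b * (b * c) = a * c" if "b \<noteq> 0" for a b c :: real using that by simp
        then show ?thesis by (simp only: of_nat_Suc[symmetric] add.commute[of _ 1] of_nat_eq_0_iff)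
      qed
      finally show ?thesis .
    qed
    have half: "(\<lambda>l. (1 / 2 :: real) ^ l) sums 2" using geometric_sums[of "1 / 2 :: real"] by simp
    have summ: "summable u"
      by (rule summable_comparison_test'[OF sums_summable[OF half], of 0]) (use u_nonneg u_le in auto)
    have "(\<Sum>l<L. u l) \<le> (\<Sum>l<L. (1 / 2) ^ Suc l * (r / 4))" by (intro sum_mono u_small) auto
    also have "\<dots> = (\<Sum>l<L. (1 / 2) ^ Suc l) * (r / 4)" by (rule sum_distrib_right[symmetric])
    also have "\<dots> \<le> 1 * (r / 4)"
    proof (rule mult_right_mono)
      have "(\<Sum>l<L. (1 / 2 :: real) ^ Suc l) \<le> (\<Sum>l. (1 / 2) ^ Suc l)"
        using sums_summable[OF power_half_series] by (intro sum_le_suminf) auto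
      then show "(\<Sum>l<L. (1 / 2 :: real) ^ Suc l) \<le> 1"
        using sums_unique[OF power_half_series] by simp
    qed (use r in simp)
    finally have head: "(\<Sum>l<L. u l) \<le> r / 4" by simp
    have "(\<Sum>n. u (n + L)) \<le> (\<Sum>n. (1 / 2) ^ n * (1 / 2) ^ L)"
      using summ sums_summable[OF half] u_le
      by (intro suminf_le summable_mult2) (auto simp: summable_iff_shift power_add[symmetric])
    also have "\<dots> = 2 * (1 / 2) ^ L"
      using sums_mult2[OF half] by (rule sums_unique[symmetric])
    finally have tail: "(\<Sum>n. u (n + L)) < r / 2" using L by simp
    have "dstar K X (Inr \<mu>) (Inl B) = (\<Sum>n. u (n + L)) + (\<Sum>l<L. u l)"
      unfolding dstar_def s_def[symmetric] u_def[symmetric] by (rule suminf_split_initial_segment[OF summ])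
    then show "dstar K X (Inr \<mu>) (Inl B) < r" using head tail r by simp
  qed
qed

section \<open>Nonergodic tiles\<close>

text \<open>The finitely many indices before the Folner threshold touch finitely many levels
  \<open>k\<close>; all shapes of later levels come after the threshold.\<close>

lemma folner_system_inv_under:
  fixes S :: "nat \<Rightarrow> 'g::group_add set list"
  assumes "folner_system S" "finite K" "K \<noteq> {}" "\<delta> > 0"
  shows "\<forall>\<^sub>F k in sequentially. \<forall>A\<in>set (S k). inv_under K \<delta> A"
proof -
  obtain b where b: "bij_betw b UNIV (SIGMA k:UNIV. {..<length (S k)})"
    and F: "folner_seq (\<lambda>n. S (fst (b n)) ! snd (b n))"
    using assms(1) by (auto simp: folner_system_def)
  obtain N where N: "\<And>n. n \<ge> N \<Longrightarrow> inv_under K \<delta> (S (fst (b n)) ! snd (b n))"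
    using F assms(2-4) unfolding folner_seq_def eventually_sequentially by blast
  define k\<^sub>0 where "k\<^sub>0 = Suc (\<Sum>n<N. fst (b n))"
  have "inv_under K \<delta> A" if k: "k \<ge> k\<^sub>0" "A \<in> set (S k)" for k A
  proof -
    obtain i where i: "i < length (S k)" "A = S k ! i" using k(2) by (auto simp: in_set_conv_nth)
    then have "(k, i) \<in> (SIGMA k:UNIV. {..<length (S k)})" by simp
    then obtain n where n: "b n = (k, i)" using b unfolding bij_betw_def by (metis imageE)
    have "n \<ge> N"
    proof (rule ccontr)
      assume "\<not> n \<ge> N"
      then have "fst (b n) \<le> (\<Sum>n<N. fst (b n))" by (intro member_le_sum) auto
      with k(1) n show False by (simp add: k\<^sub>0_def)
    qed
    from N[OF this] show ?thesis by (simp add: n i)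
  qed
  then show ?thesis unfolding eventually_sequentially by blast
qed

lemma tiling_system_tiling:
  assumes "tiling_system S T TT" "t \<in> TT"
  shows "tiling (S k) (t k)"
proof -
  have "TT \<subseteq> PiE UNIV (\<lambda>k. topspace (subtopology (symbol_space (S k)) (T k)))"
    using assms(1) closedin_subset by (fastforce simp: tiling_system_def)
  then have "t k \<in> T k" using assms(2) by (auto simp: PiE_def)
  then show ?thesis using assms(1) by (simp add: tiling_system_def dynamical_tiling_def)
qed

lemma folner_system_tiles:
  fixes S :: "nat \<Rightarrow> 'g::group_add set list"
  assumes "folner_system S" "tiling_system S T TT" "finite K" "K \<noteq> {}" "\<delta> > 0"
  shows "\<forall>\<^sub>F k in sequentially. \<forall>t\<in>TT. \<forall>A\<in>tiles (S k) (t k). inv_under K \<delta> A"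
  using folner_system_inv_under[OF assms(1,3-5)]
proof eventually_elim
  case (elim k)
  show ?case
  proof (intro ballI)
    fix t A assume t: "t \<in> TT" and A: "A \<in> tiles (S k) (t k)"
    have "tiling (S k) (t k)" using tiling_system_tiling[OF assms(2) t] .
    from tile_cases[OF this A] obtain c i where "i < length (S k)" "A = S k ! i + {c}" by metis
    then show "inv_under K \<delta> A" using elim by (simp add: inv_under_translate)
  qed
qed

section \<open>Ergodic measures along orbits and their limits\<close>

text \<open>Countability of the clopen sets lets one series, and so one extremal mean, control the
  orbit preimages of all of them.\<close>

lemma ergodic_mean_exists:
  fixes X :: "('g::{group_add, countable} \<Rightarrow> 'a::{finite, discrete_topology}) set"
  assumes "amenable TYPE('g)" and X: "subshift X" and x: "x \<in> X" and c: "c < upper_banach_density M"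
  obtains m \<mu> where "invariant_mean m" "c \<le> m M" "\<mu> \<in> erg_measures X"
    "\<And>A. A \<in> clopens X \<Longrightarrow> measure \<mu> A = m {g. shift g x \<in> A}"
proof -
  interpret algebra X "clopens X" by (rule algebra_clopens)
  have "countable (clopens X)" using X by (intro countable_clopens) (simp add: subshift_def)
  then have range: "range (from_nat_into (clopens X)) = clopens X"
    using top by (intro range_from_nat_into) auto
  obtain m\<^sub>0 where m0: "invariant_mean m\<^sub>0" "c \<le> m\<^sub>0 M"
    using upper_banach_density_mean[OF assms(1) c] .
  obtain m where m: "invariant_mean m" "c \<le> m M"
    and ext: "\<And>m\<^sub>1 m\<^sub>2 s n. invariant_mean m\<^sub>1 \<Longrightarrow> invariant_mean m\<^sub>2 \<Longrightarrow> 0 < s \<Longrightarrow> s < 1 \<Longrightarrow>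
       (\<And>D. m D = s * m\<^sub>1 D + (1 - s) * m\<^sub>2 D) \<Longrightarrow>
       m\<^sub>1 {g. shift g x \<in> from_nat_into (clopens X) n} = m {g. shift g x \<in> from_nat_into (clopens X) n}"
    using extremal_mean[OF m0, of "\<lambda>n. {g. shift g x \<in> from_nat_into (clopens X) n}"] by metis
  obtain \<mu> where "\<mu> \<in> erg_measures X" "\<And>A. A \<in> clopens X \<Longrightarrow> measure \<mu> A = m {g. shift g x \<in> A}"
  proof (rule extremal_mean_ergodic[OF X x m(1)])
    fix m\<^sub>1 m\<^sub>2 s A
    assume *: "invariant_mean m\<^sub>1" "invariant_mean m\<^sub>2" "0 < s" "s < 1"
      "\<And>D. m D = s * m\<^sub>1 D + (1 - s) * m\<^sub>2 D" "A \<in> clopens X"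
    obtain n where "A = from_nat_into (clopens X) n" using *(6) range by (metis imageE)
    then show "m\<^sub>1 {g. shift g x \<in> A} = m {g. shift g x \<in> A}" using ext[OF *(1-5)] by simp
  qed blast
  with m show ?thesis by (rule that)
qed

text \<open>Finite additivity survives the limit, compactness turns the limit into a measure, and
  closedness puts this measure into \<open>E\<close>. Applied to the ergodic measures, this is where
  the Bauer property enters.\<close>

lemma limit_of_means_measure:
  fixes X :: "('g::{group_add, countable} \<Rightarrow> 'a::{finite, discrete_topology}) set"
  assumes X: "subshift X" and F: "F \<noteq> bot" and x: "\<And>n. x n \<in> X" and m: "\<And>n. invariant_mean (m n)"
    and \<mu>: "\<And>n. \<mu> n \<in> E" "\<And>n A. A \<in> clopens X \<Longrightarrow> measure (\<mu> n) A = m n {g. shift g (x n) \<in> A}"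
    and E: "closedin (weak_star X) E" "E \<subseteq> prob_measures X"
    and q: "\<And>A. ((\<lambda>n. m n {g. shift g (x n) \<in> A}) \<longlongrightarrow> q A) F"
  obtains \<nu> where "\<nu> \<in> E" "\<And>A. A \<in> clopens X \<Longrightarrow> measure \<nu> A = q A"
proof -
  interpret algebra X "clopens X" by (rule algebra_clopens)
  have closed: "closed X" using X by (simp add: subshift_def)
  have "fin_additive (\<lambda>A. m n {g. shift g (x n) \<in> A})" for n
    using fin_additive_vimage[of "m n" UNIV "\<lambda>g. shift g (x n)"] m[of n] by (simp add: invariant_mean_def)
  then have "fin_additive q" by (intro fin_additive_limit[OF F _ q] always_eventually allI)
  from fin_additive_extends_to_measure[OF closed this] obtain \<nu> where \<nu>: "finite_measure \<nu>"
    "space \<nu> = X" "sets \<nu> = sets (restrict_space borel X)" "\<And>A. A \<in> clopens X \<Longrightarrow> measure \<nu> A = q A"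
    by auto
  have "m n {g. shift g (x n) \<in> X} = 1" for n
    using X x[of n] m[of n] by (simp add: subshift_def invariant_mean_def)
  then have "q X = 1" using q[of X] F by (simp add: tendsto_const_iff)
  then have "measure \<nu> (space \<nu>) = 1" using \<nu>(4)[OF top] \<nu>(2) by simp
  then have "prob_space \<nu>"
    by (intro prob_spaceI) (simp add: finite_measure.emeasure_eq_measure[OF \<nu>(1)])
  then have "\<nu> \<in> prob_measures X" using \<nu> by (simp add: prob_measures_def)
  then have "\<nu> \<in> E"
  proof (rule weak_star_closed_limit[OF closed E F \<mu>(1)])
    show "((\<lambda>n. measure (\<mu> n) A) \<longlongrightarrow> measure \<nu> A) F" if "A \<in> clopens X" for A
      using q[of A] by (simp add: \<mu>(2)[OF that] \<nu>(4)[OF that])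
  qed
  then show ?thesis using \<nu>(4) by (rule that)
qed

text \<open>A union of tiles with too many occurrences of \<open>C\<close> would carry a positive share of the ergodic limit
  measure \<open>\<nu>\<close>, hence a multiple of \<open>\<nu>\<close>, contradicting the excess frequency.\<close>

lemma excess_tiles_vanish:
  fixes X :: "('g::{group_add, countable} \<Rightarrow> 'a::{finite, discrete_topology}) set"
    and M :: "nat \<Rightarrow> 'g set"
  assumes X: "subshift X" and F: "F \<noteq> bot" and x: "\<And>n. x n \<in> X" and m: "\<And>n. invariant_mean (m n)"
    and \<nu>: "\<nu> \<in> erg_measures X"
    and lim: "\<And>A. A \<in> clopens X \<Longrightarrow> ((\<lambda>n. m n {g. shift g (x n) \<in> A}) \<longlongrightarrow> measure \<nu> A) F"
    and a: "\<And>A. ((\<lambda>n. m n (M n \<inter> {g. shift g (x n) \<in> A})) \<longlongrightarrow> a A) F"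
    and inv: "\<And>h \<delta>. \<delta> > 0 \<Longrightarrow>
      \<forall>\<^sub>F n in F. m n (({g. h + g \<in> M n} - M n) \<union> (M n - {g. h + g \<in> M n})) \<le> \<delta>"
    and C: "finite (dom C)" and \<eta>: "\<eta> > 0"
    and dense: "\<And>n. (measure \<nu> (cylinder X C) + \<eta>) * m n (M n)
      \<le> m n ({g. shift g (x n) \<in> cylinder X C} \<inter> M n)"
  shows "((\<lambda>n. m n (M n)) \<longlongrightarrow> 0) F"
proof -
  interpret algebra X "clopens X" by (rule algebra_clopens)
  have add: "fin_additive (m n)" and minv: "m n {g. h + g \<in> D} = m n D" for n h D
    using m by (auto simp: invariant_mean_def)
  have orbit: "shift g (x n) \<in> X" for g n using X x by (auto simp: subshift_def)
  have "fin_additive a"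
    by (intro fin_additive_limit[OF F _ a] always_eventually allI fin_additive_vimage add)
  moreover have "a A \<le> measure \<nu> A" if "A \<in> clopens X" for A
    by (rule tendsto_le[OF F lim[OF that] a])
      (auto intro!: always_eventually fin_additive_mono[OF add])
  \<comment> \<open>Moving the orbit by \<open>h\<close> replaces \<open>M n\<close> by a left
    translate, and the mass of the difference vanishes in the limit.\<close>
  moreover have "a (shift h -` A \<inter> X) = a A" for h A
  proof -
    let ?d = "\<lambda>n. m n (M n \<inter> {g. shift g (x n) \<in> shift h -` A \<inter> X}) - m n (M n \<inter> {g. shift g (x n) \<in> A})"
    let ?s = "\<lambda>n. m n (({g. h + g \<in> M n} - M n) \<union> (M n - {g. h + g \<in> M n}))"
    have "norm (?d n) \<le> ?s n" for n
    proof -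
      let ?D = "{g. shift g (x n) \<in> shift h -` A \<inter> X}"
      have "{g. h + g \<in> M n \<inter> {g. shift g (x n) \<in> A}} = ?D \<inter> {g. h + g \<in> M n}"
        using orbit by (auto simp: shift_shift)
      then have "m n (M n \<inter> {g. shift g (x n) \<in> A}) = m n (?D \<inter> {g. h + g \<in> M n})"
        using minv[of n h "M n \<inter> {g. shift g (x n) \<in> A}"] by simp
      then show ?thesis
        using fin_additive_Int_diff_le[OF add, of n ?D "M n" "{g. h + g \<in> M n}"]
        by (simp add: Int_commute Un_commute)
    qed
    moreover have "(?s \<longlongrightarrow> 0) F"
    proof (rule tendstoI)
      fix e :: real assume "e > 0"
      then have "\<forall>\<^sub>F n in F. ?s n \<le> e / 2" by (intro inv) simp
      then show "\<forall>\<^sub>F n in F. dist (?s n) 0 < e"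
        by eventually_elim (use fin_additive_nonneg[OF add] \<open>e > 0\<close> in \<open>auto simp: dist_real_def\<close>)
    qed
    ultimately have "(?d \<longlongrightarrow> 0) F"
      using Lim_null_comparison[of ?d ?s F] by (simp add: always_eventually)
    moreover have "(?d \<longlongrightarrow> a (shift h -` A \<inter> X) - a A) F" by (intro tendsto_diff a)
    ultimately show ?thesis using tendsto_unique[OF F] by fastforce
  qed
  ultimately have a_cyl: "a (cylinder X C) = a X * measure \<nu> (cylinder X C)"
    by (intro ergodic_dominates_invariant[OF X \<nu>] cylinder_clopen[OF C])
  have M_lim: "((\<lambda>n. m n (M n)) \<longlongrightarrow> a X) F" using a[of X] orbit by simp
  \<comment> \<open>This is the limit of \<open>dense\<close>. By \<open>a_cyl\<close> the common
    term \<open>a X * measure \<nu> (cylinder X C)\<close> cancels and leaves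
    \<open>\<eta> * a X \<le> 0\<close>.\<close>
  have "(measure \<nu> (cylinder X C) + \<eta>) * a X \<le> a (cylinder X C)"
    using dense by (intro tendsto_le[OF F a tendsto_mult[OF tendsto_const M_lim]] always_eventually)
      (auto simp: Int_commute)
  then have "\<eta> * a X \<le> 0" unfolding a_cyl by (simp add: algebra_simps)
  moreover have "a X \<ge> 0"
    using tendsto_lowerbound[OF M_lim _ F] fin_additive_nonneg[OF add] by simp
  ultimately have "a X = 0" using \<eta> by (simp add: mult_le_0_iff)
  with M_lim show ?thesis by simp
qed

text \<open>An occurrence of \<open>C\<close> at \<open>g\<close> in the block over \<open>A\<close>
  is a visit of \<open>shift g x\<close> to the cylinder. Only an inequality results, since
  occurrences sticking out of \<open>A\<close> are visits that \<open>Fr\<close> does not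
  count.\<close>

lemma frequent_block_tile:
  fixes X :: "('g::group_add \<Rightarrow> 'a::{finite, discrete_topology}) set"
  assumes X: "subshift X" and x: "x \<in> X" and A: "finite A" "A \<noteq> {}" and Fr: "\<theta> \<le> Fr (restr x A) C"
  shows "\<theta> * real (card A) \<le> real (card ({g. shift g x \<in> cylinder X C} \<inter> A))"
proof -
  let ?G = "{g \<in> core (dom C) A. matches C (restr x A) g}"
  have "?G \<subseteq> {g. shift g x \<in> cylinder X C} \<inter> A"
  proof
    fix g assume g: "g \<in> ?G"
    have "C k = Some (shift g x k)" if "k \<in> dom C" for k
    proof -
      have "k + g \<in> A" using g that by (auto simp: core_def plus_singleton_eq)
      moreover have "restr x A (k + g) = C k" using g that by (simp add: matches_def)
      ultimately show ?thesis by (simp add: restr_def shift_def)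
    qed
    moreover have "shift g x \<in> X" "g \<in> A" using X x g by (auto simp: subshift_def core_def)
    ultimately show "g \<in> {g. shift g x \<in> cylinder X C} \<inter> A" by (simp add: cylinder_eq)
  qed
  then have "card ?G \<le> card ({g. shift g x \<in> cylinder X C} \<inter> A)"
    using A by (intro card_mono) auto
  moreover have "\<theta> * real (card A) \<le> real (card ?G)"
    using Fr A by (simp add: Fr_def pos_le_divide_eq card_gt_0_iff)
  ultimately show ?thesis by simp
qed

theorem theorem5p8:
  fixes X :: "('g::{group_add, countable} \<Rightarrow> 'a::{finite, discrete_topology}) set"
    and K :: "nat \<Rightarrow> 'g set"
    and S :: "nat \<Rightarrow> 'g set list"
    and T :: "nat \<Rightarrow> ('g \<Rightarrow> nat option) set"
    and TT :: "(nat \<Rightarrow> 'g \<Rightarrow> nat option) set"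
    and U :: "('g, 'a) block_or_measure set"
    and \<epsilon> :: real
  assumes "infinite (UNIV :: 'g set)"
    and "amenable TYPE('g)"
    and "subshift X"
    and "closedin (weak_star X) (erg_measures X)"
    and "bij_betw K UNIV {F. finite F}"
    and "tiling_system S T TT"
    and "folner_system S"
    and "deterministic_system S TT"
    and "dstar_open K X U"
    and "Inr ` erg_measures X \<subseteq> U"
    and "\<epsilon> > 0"
  shows "\<exists>j0. \<forall>j\<ge>j0. \<forall>x\<in>X. \<forall>t\<in>TT.
           upper_banach_density (nonergodic_union U (S j) x (t j)) < \<epsilon>"
proof (rule ccontr)
  assume neg: "\<not> ?thesis"
  \<comment> \<open>Halving \<epsilon> provides the strict inequality from which a mean is
    constructed.\<close>
  have "\<exists>j x t. n \<le> j \<and> x \<in> X \<and> t \<in> TT \<and>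
      \<epsilon> / 2 < upper_banach_density (nonergodic_union U (S j) x (t j))" for n
  proof -
    obtain j x t where "n \<le> j" "x \<in> X" "t \<in> TT"
      "\<not> upper_banach_density (nonergodic_union U (S j) x (t j)) < \<epsilon>" using neg by blast
    moreover have "\<epsilon> / 2 < \<epsilon>" using \<open>\<epsilon> > 0\<close> by simp
    ultimately show ?thesis by (meson less_le_trans not_less)
  qed
  then obtain j x t where j: "\<And>n. n \<le> j n" and x: "\<And>n. x n \<in> X" and t: "\<And>n. t n \<in> TT"
    and density: "\<And>n. \<epsilon> / 2 < upper_banach_density (nonergodic_union U (S (j n)) (x n) (t n (j n)))"
    by metis
  define N where "N n = nonergodic_union U (S (j n)) (x n) (t n (j n))" for n
  define tls where "tls n = tiles (S (j n)) (t n (j n))" for n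
  have tiling: "tiling (S (j n)) (t n (j n))" for n by (rule tiling_system_tiling[OF assms(6) t])
  have shapes: "shape_collection (S (j n))" for n
    using assms(6) by (simp add: tiling_system_def dynamical_tiling_def)
  have inv_tiles: "\<forall>\<^sub>F n in sequentially. \<forall>A\<in>tls n. inv_under K' \<delta> A"
    if K': "finite K'" "K' \<noteq> {}" "\<delta> > 0" for K' \<delta>
  proof -
    obtain k where "\<forall>i\<ge>k. \<forall>t\<in>TT. \<forall>A\<in>tiles (S i) (t i). inv_under K' \<delta> A"
      using folner_system_tiles[OF assms(7,6) K'] unfolding eventually_sequentially ..
    then have "\<forall>n\<ge>k. \<forall>A\<in>tls n. inv_under K' \<delta> A"
      using t j unfolding tls_def by (meson order.trans)
    then show ?thesis unfolding eventually_sequentially ..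
  qed
  have tile_fin: "finite A \<and> A \<noteq> {}" if A: "A \<in> tls n" for A n
  proof -
    obtain c i where "i < length (S (j n))" "A = S (j n) ! i + {c}"
      using tile_cases[OF tiling A[unfolded tls_def]] by metis
    moreover from this have "finite (S (j n) ! i) \<and> 0 \<in> S (j n) ! i"
      using shapes[of n] nth_mem[of i "S (j n)"] unfolding shape_collection_def by blast
    ultimately show ?thesis by (auto simp: plus_singleton_eq)
  qed
  have "\<exists>m \<mu>. invariant_mean m \<and> \<epsilon> / 2 \<le> m (N n) \<and> \<mu> \<in> erg_measures X \<and>
      (\<forall>A\<in>clopens X. measure \<mu> A = m {g. shift g (x n) \<in> A})" for n
    using ergodic_mean_exists[OF assms(2,3) x density[of n]] unfolding N_def by metis
  then obtain m \<mu> where m: "\<And>n. invariant_mean (m n)" and mN: "\<And>n. \<epsilon> / 2 \<le> m n (N n)"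
    and \<mu>: "\<And>n. \<mu> n \<in> erg_measures X"
    and \<mu>m: "\<And>n A. A \<in> clopens X \<Longrightarrow> measure (\<mu> n) A = m n {g. shift g (x n) \<in> A}" by metis
  have m_add: "fin_additive (m n)" for n using m by (simp add: invariant_mean_def)
  obtain F\<^sub>1 q where F1: "F\<^sub>1 \<noteq> bot" "F\<^sub>1 \<le> sequentially"
    and q: "\<And>A. ((\<lambda>n. m n {g. shift g (x n) \<in> A}) \<longlongrightarrow> q A) F\<^sub>1"
    by (rule convergent_finer_filter[of sequentially "\<lambda>n A. m n {g. shift g (x n) \<in> A}"])
      (use fin_additive_nonneg[OF m_add] invariant_mean_le_1[OF m] in auto)
  have erg_prob: "erg_measures X \<subseteq> prob_measures X" by (auto simp: erg_measures_def inv_measures_def)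
  obtain \<nu> where \<nu>: "\<nu> \<in> erg_measures X" and \<nu>q: "\<And>A. A \<in> clopens X \<Longrightarrow> measure \<nu> A = q A"
    by (rule limit_of_means_measure[OF assms(3) F1(1) x m \<mu> \<mu>m assms(4) erg_prob q]) blast+
  \<comment> \<open>The radius \<open>r\<close> belongs to the single limit measure, so the test
    blocks, the excess and the required invariance do not depend on \<open>n\<close>.\<close>
  have "Inr \<nu> \<in> U" using assms(10) \<nu> by auto
  then obtain r where r: "r > 0"
    "\<And>p. p \<in> blocks_and_measures X \<Longrightarrow> dstar K X (Inr \<nu>) p < r \<Longrightarrow> p \<in> U"
    using assms(9) unfolding dstar_open_def by blast
  have \<nu>_prob: "\<nu> \<in> prob_measures X" using \<nu> erg_prob by auto
  have finK: "finite (K l)" for l using bij_betwE[OF assms(5)] by simp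
  obtain I \<eta> K' \<delta> where I: "finite I" "\<And>C. C \<in> I \<Longrightarrow> finite (dom C)" and \<eta>: "\<eta> > 0"
    and K': "finite K'" "K' \<noteq> {}" "\<delta> > 0"
    and small: "\<And>B. inv_under K' \<delta> (dom B) \<Longrightarrow>
      (\<And>C. C \<in> I \<Longrightarrow> Fr B C < measure \<nu> (cylinder X C) + \<eta>) \<Longrightarrow> dstar K X (Inr \<nu>) (Inl B) < r"
    by (rule dstar_small[of \<nu> X K, OF \<nu>_prob finK r(1)]) blast
  define Q where "Q C n = {A \<in> tls n. measure \<nu> (cylinder X C) + \<eta> \<le> Fr (restr (x n) A) C}" for C n
  have Q: "Q C n \<subseteq> tiles (S (j n)) (t n (j n))" for C n by (auto simp: Q_def tls_def)
  \<comment> \<open>Indexing by pairs of a block and a set makes one filter serve all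
    \<open>C\<close> in \<open>I\<close>.\<close>
  obtain F\<^sub>2 a where F2: "F\<^sub>2 \<noteq> bot" "F\<^sub>2 \<le> F\<^sub>1"
    and a: "\<And>p. ((\<lambda>n. m n (\<Union>(Q (fst p) n) \<inter> {g. shift g (x n) \<in> snd p})) \<longlongrightarrow> a p) F\<^sub>2"
    by (rule convergent_finer_filter[of F\<^sub>1 "\<lambda>n p. m n (\<Union>(Q (fst p) n) \<inter> {g. shift g (x n) \<in> snd p})"])
      (use F1 fin_additive_nonneg[OF m_add] invariant_mean_le_1[OF m] in auto)
  have F2_seq: "F\<^sub>2 \<le> sequentially" using F2(2) F1(2) by (rule order.trans)
  have "((\<lambda>n. m n (\<Union>(Q C n))) \<longlongrightarrow> 0) F\<^sub>2" if C: "C \<in> I" for C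
  proof (rule excess_tiles_vanish[OF assms(3) F2(1) x m \<nu> _ _ _ I(2)[OF C] \<eta>])
    show "((\<lambda>n. m n {g. shift g (x n) \<in> A}) \<longlongrightarrow> measure \<nu> A) F\<^sub>2" if "A \<in> clopens X" for A
      using tendsto_mono[OF F2(2) q] by (simp add: \<nu>q[OF that])
    show "((\<lambda>n. m n (\<Union>(Q C n) \<inter> {g. shift g (x n) \<in> A})) \<longlongrightarrow> a (C, A)) F\<^sub>2" for A
      using a[of "(C, A)"] by simp
    show "\<forall>\<^sub>F n in F\<^sub>2. m n (({g. h + g \<in> \<Union>(Q C n)} - \<Union>(Q C n)) \<union>
        (\<Union>(Q C n) - {g. h + g \<in> \<Union>(Q C n)})) \<le> \<delta>'" if "\<delta>' > 0" for h \<delta>'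
    proof -
      have "\<forall>\<^sub>F n in F\<^sub>2. \<forall>A\<in>tls n. inv_under {h} (\<delta>' / 2) A"
        using inv_tiles[of "{h}" "\<delta>' / 2"] that F2_seq by (simp add: le_filter_def)
      then show ?thesis
      proof eventually_elim
        case (elim n)
        have "m n (({g. h + g \<in> \<Union>(Q C n)} - \<Union>(Q C n)) \<union> (\<Union>(Q C n) - {g. h + g \<in> \<Union>(Q C n)}))
            \<le> 2 * (\<delta>' / 2)"
          using elim that by (intro mean_tiles_symdiff_le[OF shapes tiling m Q]) (auto simp: Q_def)
        then show ?case by simp
      qed
    qed
    show "(measure \<nu> (cylinder X C) + \<eta>) * m n (\<Union>(Q C n))
        \<le> m n ({g. shift g (x n) \<in> cylinder X C} \<inter> \<Union>(Q C n))" for n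
      using tile_fin[of _ n]
      by (intro mean_tiles_lower_bound[OF shapes tiling m Q] frequent_block_tile[OF assms(3) x])
        (auto simp: Q_def)
  qed
  then have "((\<lambda>n. \<Sum>C\<in>I. m n (\<Union>(Q C n))) \<longlongrightarrow> (\<Sum>C\<in>I. 0)) F\<^sub>2" by (intro tendsto_sum)
  then have "\<forall>\<^sub>F n in F\<^sub>2. (\<Sum>C\<in>I. m n (\<Union>(Q C n))) < \<epsilon> / 2"
    using \<open>\<epsilon> > 0\<close> by (intro order_tendstoD(2)) auto
  moreover have "\<forall>\<^sub>F n in F\<^sub>2. \<forall>A\<in>tls n. inv_under K' \<delta> A"
    using inv_tiles[OF K'] F2_seq by (simp add: le_filter_def)
  ultimately have "\<forall>\<^sub>F n in F\<^sub>2. False"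
  proof eventually_elim
    case (elim n)
    \<comment> \<open>The block on a nonergodic tile has distance at least \<open>r\<close> from
      \<nu>, so some \<open>C\<close> in \<open>I\<close> occurs in it too often. The masses of
      these finitely many unions add up to less than \<open>\<epsilon> / 2\<close>, contradicting
      \<open>mN\<close>.\<close>
    have "N n \<subseteq> (\<Union>C\<in>I. \<Union>(Q C n))"
    proof
      fix g assume "g \<in> N n"
      then obtain A where A: "A \<in> tls n" "Inl (restr (x n) A) \<notin> U" "g \<in> A"
        by (auto simp: N_def nonergodic_union_def tls_def)
      have "occurs_in (restr (x n) A) (x n)"
        unfolding occurs_in_def matches_def by (intro exI[of _ 0]) (auto simp: restr_def)
      then have "restr (x n) A \<in> all_blocks X"
        using tile_fin[OF A(1)] x[of n] unfolding all_blocks_def mem_Collect_eq dom_restr by blast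
      then have "Inl (restr (x n) A) \<in> blocks_and_measures X" by (simp add: blocks_and_measures_def)
      then have "\<not> dstar K X (Inr \<nu>) (Inl (restr (x n) A)) < r" using r(2) A(2) by blast
      moreover have "inv_under K' \<delta> (dom (restr (x n) A))" using elim(2) A(1) by simp
      ultimately obtain C where "C \<in> I" "measure \<nu> (cylinder X C) + \<eta> \<le> Fr (restr (x n) A) C"
        using small by (meson not_less)
      then show "g \<in> (\<Union>C\<in>I. \<Union>(Q C n))" using A by (auto simp: Q_def)
    qed
    then have "m n (N n) \<le> m n (\<Union>C\<in>I. \<Union>(Q C n))" by (rule fin_additive_mono[OF m_add])
    also have "\<dots> \<le> (\<Sum>C\<in>I. m n (\<Union>(Q C n)))" by (rule fin_additive_UN_le[OF m_add I(1)])
    finally show ?case using mN[of n] elim(1) by simp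
  qed
  with F2(1) show False by simp
qed

end
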